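(* Let $d\ge2$. For each $n$, let $P_{\kappa_n}$ denote the joint law of $n$ i.i.d. observations $\bm x_1,\dots,\bm x_n$ from some distribution on $\mathbb{S}^{d-1}$ (which may depend on $n$), and let $P_0$ denote the joint law of $n$ i.i.d. observations from the uniform distribution on $\mathbb{S}^{d-1}$. Let $\hat k$ be the data-driven index, computed from $\bm x_1,\dots,\bm x_n$, of the data-driven Sobolev test. If $P_{\kappa_n}\lhd P_0$, then $$P_{\kappa_n}[\hat k=1]\longrightarrow 1\quad\text{as } n\to\infty .$$
   Context: $\mathbb{S}^{d-1}=\{\bm x\in\mathbb{R}^d:\|\bm x\|=1\}$. For $k\ge1$, $$d_k=\binom{d+k-3}{d-2}+\binom{d+k-2}{d-2},\qquad c_{k,j}^{\lambda}=\frac{2^{k-2j}\,\Gamma(k-j+\lambda)}{\Gamma(\lambda)\,j!\,(k-2j)!},$$ and for $t\in[-1,1]$, $$h_k(t)=\begin{cases}2\cos(k\arccos t), & d=2,\\ \left(1+\frac{2k}{d-2}\right)\sum_{j=0}^{\lfloor k/2\rfloor}(-1)^j c_{k,j}^{(d-2)/2}\,t^{k-2j}, & d>2.\end{cases}$$ Given observations $\bm x_1,\dots,\bm x_n\in\mathbb{S}^{d-1}$, for $K\ge1$ put $$S_K=\frac1n\sum_{i,j=1}^n\sum_{k=1}^K h_k(\bm x_i^\top\bm x_j),\qquad p_K=\sum_{k=1}^K d_k,\qquad B_S(K)=S_K-p_K\log n .$$ With $\mathbb{N}=\{1,2,\dots\}$, $$\hat k=\inf\Bigl\{K\in\mathbb{N}: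 B_S(K)=\sup_{m\in\mathbb{N}}B_S(m)\Bigr\}.$$ The data-driven Sobolev test statistic is $S_{\hat k}$. Contiguity: for sequences of probability measures, $Q_n\lhd P_n$ means that for every sequence of measurable sets $A_n$, $P_n(A_n)\to0$ implies $Q_n(A_n)\to0$. *)

theory Defs
  imports "HOL-Probability.Probability"
begin

text \<open>
  The index \<^typ>\<open>'d\<close> enumerates the coordinates of \<open>\<real>\<^sup>d\<close>, so \<open>d\<close> is \<open>CARD('d)\<close>.
\<close>

definition unit_sphere_space :: "(real^'d) measure" where
  "unit_sphere_space = restrict_space borel (sphere 0 1)"

text \<open>
  Normalised surface measure in polar coordinates: a Borel set \<open>A\<close> of unit vectors has as its
  probability the fraction of the volume of the unit ball occupied by the cone
  \<open>{r *\<^sub>R a | r a. 0 < r < 1 \<and> a \<in> A}\<close>.  The outer restriction removes the value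
  \<^term>\<open>sgn 0 = 0\<close>, which is attained with probability 0.
\<close>

definition uniform_sphere :: "(real^'d) measure" where
  "uniform_sphere = restrict_space (distr (uniform_measure lborel (ball 0 1)) borel sgn) (sphere 0 1)"

definition iid_law :: "nat \<Rightarrow> 'a measure \<Rightarrow> (nat \<Rightarrow> 'a) measure" where
  "iid_law n \<mu> = (\<Pi>\<^sub>M i\<in>{1..n}. \<mu>)"

definition contiguous :: "(nat \<Rightarrow> 'a measure) \<Rightarrow> (nat \<Rightarrow> 'a measure) \<Rightarrow> bool"  (infix \<open>\<lhd>\<^sub>c\<close> 50) where
  "Q \<lhd>\<^sub>c P \<longleftrightarrow>
     (\<forall>A. (\<forall>n. A n \<in> sets (P n)) \<longrightarrow>
          (\<lambda>n. measure (P n) (A n)) \<longlonglongrightarrow> 0 \<longrightarrow> (\<lambda>n. measure (Q n) (A n)) \<longlonglongrightarrow> 0)"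

definition dim_harm :: "nat \<Rightarrow> nat \<Rightarrow> nat" where
  "dim_harm d k = ((d + k - 3) choose (d - 2)) + ((d + k - 2) choose (d - 2))"

definition gegenbauer_coeff :: "real \<Rightarrow> nat \<Rightarrow> nat \<Rightarrow> real" where
  "gegenbauer_coeff l k j =
     2 ^ (k - 2 * j) * Gamma (real k - real j + l) / (Gamma l * fact j * fact (k - 2 * j))"

definition sobolev_h :: "nat \<Rightarrow> nat \<Rightarrow> real \<Rightarrow> real" where
  "sobolev_h d k t =
     (if d = 2 then 2 * cos (real k * arccos t)
      else (1 + 2 * real k / (real d - 2)) *
           (\<Sum>j = 0..k div 2. (- 1) ^ j * gegenbauer_coeff ((real d - 2) / 2) k j * t ^ (k - 2 * j)))"

definition sobolev_stat :: "nat \<Rightarrow> (nat \<Rightarrow> real^'d) \<Rightarrow> nat \<Rightarrow> real" where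
  "sobolev_stat n x K =
     1 / real n * (\<Sum>i = 1..n. \<Sum>j = 1..n. \<Sum>k = 1..K. sobolev_h CARD('d) k (x i \<bullet> x j))"

definition penalty_dim :: "nat \<Rightarrow> nat \<Rightarrow> nat" where
  "penalty_dim d K = (\<Sum>k = 1..K. dim_harm d k)"

definition B_S :: "nat \<Rightarrow> (nat \<Rightarrow> real^'d) \<Rightarrow> nat \<Rightarrow> real" where
  "B_S n x K = sobolev_stat n x K - real (penalty_dim CARD('d) K) * ln (real n)"

text \<open>
  The supremum may be infinite or not attained (for instance when all observations coincide);
  hence it is taken in the extended reals, and the infimum in \<^typ>\<open>enat\<close>, where the infimum of the
  empty set is \<open>\<infinity>\<close>.
\<close>

definition k_hat :: "nat \<Rightarrow> (nat \<Rightarrow> real^'d) \<Rightarrow> enat" where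
  "k_hat n x = Inf {enat K | K. K \<ge> 1 \<and> ereal (B_S n x K) = (SUP m\<in>{1..}. ereal (B_S n x m))}"

lemma sets_uniform_sphere: "sets uniform_sphere = sets unit_sphere_space"
  by (simp add: uniform_sphere_def unit_sphere_space_def sets_restrict_space)

lemma prob_space_uniform_sphere: "prob_space (uniform_sphere :: (real^'d) measure)"
proof -
  let ?U = "uniform_measure lborel (ball 0 1) :: (real^'d) measure"
  have "unit_ball_vol (real CARD('d)) > 0"
    by simp
  then have e: "emeasure lborel (ball (0::real^'d) 1) \<noteq> 0"
    by (simp add: emeasure_ball less_le)
  have f: "emeasure lborel (ball (0::real^'d) 1) \<noteq> \<infinity>"
    using emeasure_lborel_ball_finite[of "0::real^'d" 1] by auto
  interpret U: prob_space ?U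
    by (rule prob_space_uniform_measure[OF e f])
  have m: "(sgn :: real^'d \<Rightarrow> real^'d) \<in> borel_measurable borel"
    unfolding sgn_div_norm by measurable
  then have mU: "sgn \<in> measurable ?U borel"
    by simp
  have "{0::real^'d} \<in> null_sets lborel"
    by (simp add: null_setsI)
  then have "AE x in lborel. (x::real^'d) \<noteq> 0"
    by (rule AE_I') auto
  then have "AE x in ?U. x \<noteq> 0"
    by (intro AE_uniform_measureI) auto
  then have "AE x in ?U. sgn x \<in> sphere 0 1"
    by eventually_elim (simp add: norm_sgn)
  then have "AE x in distr ?U borel sgn. x \<in> sphere 0 1"
    by (subst AE_distr_iff[OF mU]) auto
  then show ?thesis
    unfolding uniform_sphere_def
    by (intro prob_space_restrict_space prob_space.emeasure_eq_1_AE
        U.prob_space_distr mU) auto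
qed

end

theory Submission
  imports Defs "HOL-Computational_Algebra.Polynomial"
begin

text \<open>
  By contiguity it suffices to treat uniform observations. There \<open>h\<^sub>k = d\<^sub>k R\<^sub>k\<close> with \<open>R\<^sub>k(1) = 1\<close>, and
  under the law of \<open>u \<bullet> y\<close> for uniform \<open>u\<close> the \<open>R\<^sub>k\<close> are orthogonal with \<open>d\<^sub>k E R\<^sub>k\<^sup>2 = 1\<close>. Hence
  \<open>S\<^sub>m - S\<^sub>1\<close> has mean \<open>q\<^sub>m = d\<^sub>2 + \<dots> + d\<^sub>m\<close> and variance at most \<open>2 q\<^sub>m\<close>, and by Chebyshev it exceeds
  \<open>q\<^sub>m log n\<close> with probability at most \<open>2 / (q\<^sub>m (log n - 1)\<^sup>2)\<close>. For \<open>d \<ge> 3\<close> the sum over \<open>m\<close> converges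
  and tends to 0. For \<open>d = 2\<close>, where \<open>q\<^sub>m\<close> grows only linearly, \<open>S\<^sub>m\<close> is nondecreasing in \<open>m\<close>, so dyadic
  \<open>m\<close> suffice.
\<close>

section \<open>Normalised Gegenbauer polynomials\<close>

text \<open>The supremum behind the index runs over all degrees at once, so no cutoff on
  \<open>m\<close> is available and the argument rests on a countable union bound. Second moments
  are enough because the penalty exceeds the mean by \<open>q\<^sub>m (log n - 1)\<close> while the
  fluctuations are only of order \<open>sqrt q\<^sub>m\<close>. The mean is not random at all: the
  diagonal terms have inner product 1 and contribute exactly \<open>q\<^sub>m\<close>, which is the
  source of the 1 in \<open>log n - 1\<close>. What is left is a sum over distinct pairs whose terms
  are uncorrelated up to exchanging the two indices. The density of the inner product, proportional
  to (1 - t^2)^((d-3)/2), never appears. Only its moments enter, and these follow from rotation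
  invariance and the identity |u| = 1. Rotation invariance has to be derived first, because the
  uniform law is given through volumes of cones in the unit ball.\<close>

text \<open>Scaled to the value 1 at 1, with \<open>e = d - 2\<close>; this keeps the case \<open>d = 2\<close> (Chebyshev
  polynomials), where the usual Gegenbauer polynomials degenerate.\<close>

fun gegen :: "real \<Rightarrow> nat \<Rightarrow> real poly" where
  "gegen e 0 = 1"
| "gegen e (Suc 0) = [:0, 1:]"
| "gegen e (Suc (Suc k)) =
     smult (1 / (real k + 1 + e))
       (smult (2 * (real k + 1) + e) ([:0, 1:] * gegen e (Suc k)) - smult (real k + 1) (gegen e k))"

lemma gegen_recurrence:
  assumes "e \<ge> 0"
  shows "smult (real k + 1 + e) (gegen e (Suc (Suc k))) =
    smult (2 * (real k + 1) + e) ([:0, 1:] * gegen e (Suc k)) - smult (real k + 1) (gegen e k)"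
proof -
  have "real k + 1 + e \<noteq> 0" using assms by linarith
  then show ?thesis by simp
qed

lemma poly_gegen_recurrence:
  assumes "e \<ge> 0"
  shows "(real k + 1 + e) * poly (gegen e (Suc (Suc k))) t =
    (2 * (real k + 1) + e) * (t * poly (gegen e (Suc k)) t) - (real k + 1) * poly (gegen e k) t"
proof -
  have "poly (smult (real k + 1 + e) (gegen e (Suc (Suc k)))) t =
    poly (smult (2 * (real k + 1) + e) ([:0, 1:] * gegen e (Suc k)) - smult (real k + 1) (gegen e k)) t"
    by (simp only: gegen_recurrence[OF assms])
  then show ?thesis by (simp del: gegen.simps)
qed

declare gegen.simps(3)[simp del]

text \<open>At t = 1 the coefficients balance: 2(k+1) + e - (k+1) = k+1+e, so the value 1 reproduces
  itself.\<close>

lemma poly_gegen_1: "e \<ge> 0 \<Longrightarrow> poly (gegen e k) 1 = 1"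
proof (induction e k rule: gegen.induct)
  case (3 e k)
  have "real k + 1 + e \<noteq> 0" using 3 by linarith
  moreover have "(real k + 1 + e) * poly (gegen e (Suc (Suc k))) 1 = (real k + 1 + e) * 1"
    using poly_gegen_recurrence[OF 3(3), of k 1] 3 by (simp add: algebra_simps)
  ultimately show ?case by (metis mult_left_cancel)
qed auto

lemma degree_gegen: "degree (gegen e k) \<le> k"
proof (induction e k rule: gegen.induct)
  case (3 e k)
  have "degree ([:0, 1:] * gegen e (Suc k)) \<le> Suc (Suc k)"
    using degree_mult_le[of "[:0,1:]" "gegen e (Suc k)"] 3 by simp
  then have "degree (smult (2 * (real k + 1) + e) ([:0, 1:] * gegen e (Suc k))) \<le> Suc (Suc k)"
    using degree_smult_le le_trans by blast
  moreover have "degree (smult (real k + 1) (gegen e k)) \<le> Suc (Suc k)"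
    using 3(2) degree_smult_le[of "real k + 1" "gegen e k"] by linarith
  ultimately show ?case
    unfolding gegen.simps(3) by (meson degree_diff_le degree_smult_le le_trans)
qed auto

text \<open>The moments \<open>a\<^sub>k\<^sub>,\<^sub>j\<close> of \<open>R\<^sub>k(t) t\<^sup>j\<close> satisfy
  \<open>(j + k + e) a\<^sub>k\<^sub>,\<^sub>j = j a\<^sub>k\<^sub>-\<^sub>1\<^sub>,\<^sub>j\<^sub>-\<^sub>1\<close>, from which orthogonality is immediate.\<close>

locale gegenbauer_functional =
  fixes e :: real and L :: "real poly \<Rightarrow> real"
  assumes e_nonneg: "e \<ge> 0"
    and L_add: "L (p + q) = L p + L q"
    and L_smult: "L (smult c p) = c * L p"
    and L_one: "L 1 = 1"
    and L_x: "L (monom 1 1) = 0"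
    and L_moment: "(real n + 2 + e) * L (monom 1 (n + 2)) = (real n + 1) * L (monom 1 n)"
begin

lemma L_diff: "L (p - q) = L p - L q"
  using L_add[of "p - q" q] by simp

lemma L_zero: "L 0 = 0"
  using L_add[of 0 0] by simp

lemma L_sum: "L (sum f A) = (\<Sum>x\<in>A. L (f x))"
  by (induction A rule: infinite_finite_induct) (auto simp: L_zero L_add)

abbreviation gmom :: "nat \<Rightarrow> nat \<Rightarrow> real" where
  "gmom k j \<equiv> L (gegen e k * monom 1 j)"

lemma gmom_rec:
  "(real k + 1 + e) * gmom (Suc (Suc k)) j =
     (2 * (real k + 1) + e) * gmom (Suc k) (Suc j) - (real k + 1) * gmom k j"
proof -
  have "smult (real k + 1 + e) (gegen e (Suc (Suc k)) * monom 1 j) =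
     smult (2 * (real k + 1) + e) (gegen e (Suc k) * monom 1 (Suc j))
      - smult (real k + 1) (gegen e k * monom 1 j)"
    unfolding mult_smult_left[symmetric] gegen_recurrence[OF e_nonneg]
    by (simp add: algebra_simps monom_Suc)
  then show ?thesis
    by (metis L_diff L_smult)
qed

text \<open>The shift relation eliminates the middle term of the three-term recurrence, since
  (2(k+1)+e)(j+1) - (k+1)(j+k+2+e) = (k+1+e)(j-k). It is assumed for this one \<open>k\<close> only,
  so that the lemma can be used inside the induction that proves the shift relation.\<close>

lemma gmom_shift_imp_skip:
  assumes "\<And>j. (real j + real k + 2 + e) * gmom (Suc k) (Suc j) = (real j + 1) * gmom k j"
  shows "(real j + real k + 2 + e) * gmom (Suc (Suc k)) j = (real j - real k) * gmom k j"
proof -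
  have pos: "real k + 1 + e > 0" using e_nonneg by linarith
  have "(real k + 1 + e) * ((real j + real k + 2 + e) * gmom (Suc (Suc k)) j) =
      (2 * (real k + 1) + e) * ((real j + real k + 2 + e) * gmom (Suc k) (Suc j))
      - (real k + 1) * (real j + real k + 2 + e) * gmom k j"
    using gmom_rec[of k j] by algebra
  also have "\<dots> = (2 * (real k + 1) + e) * ((real j + 1) * gmom k j)
      - (real k + 1) * (real j + real k + 2 + e) * gmom k j"
    by (simp only: assms)
  also have "\<dots> = (real k + 1 + e) * ((real j - real k) * gmom k j)"
    by algebra
  finally show ?thesis using pos by simp
qed

text \<open>Degree 0 is the moment recursion, and degree 1 follows by skipping from degree 0. From
  degree i+2 on, two skips (i+1 to i+3, and i to i+2) are linked by the shift relation at i. The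
  factor j-i, which may vanish, is only substituted; the factor cancelled is the positive
  j+i+2+e.\<close>

lemma gmom_shift:
  "(real j + real k + 2 + e) * gmom (Suc k) (Suc j) = (real j + 1) * gmom k j"
proof (induction k arbitrary: j rule: less_induct)
  case (less k)
  consider "k = 0" | "k = 1" | i where "k = Suc (Suc i)"
    by (metis One_nat_def not0_implies_Suc)
  then show ?case
  proof cases
    case 1
    then show ?thesis using L_moment[of j] by (simp add: monom_Suc)
  next
    case 2
    have "(real (Suc j) + real 0 + 2 + e) * gmom (Suc (Suc 0)) (Suc j)
        = (real (Suc j) - real 0) * gmom 0 (Suc j)"
      by (rule gmom_shift_imp_skip) (use less[of 0] 2 in simp)
    then show ?thesis using 2 by (simp add: monom_Suc algebra_simps)
  next
    case (3 i)
    have s1: "(real (Suc j) + real (Suc i) + 2 + e) * gmom (Suc (Suc (Suc i))) (Suc j)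
        = (real (Suc j) - real (Suc i)) * gmom (Suc i) (Suc j)"
      by (rule gmom_shift_imp_skip) (use less[of "Suc i"] 3 in simp)
    have s2: "(real j + real i + 2 + e) * gmom (Suc (Suc i)) j = (real j - real i) * gmom i j"
      by (rule gmom_shift_imp_skip) (use less[of i] 3 in simp)
    have s3: "(real j + real i + 2 + e) * gmom (Suc i) (Suc j) = (real j + 1) * gmom i j"
      using less[of i] 3 by simp
    have pos: "real j + real i + 2 + e > 0" using e_nonneg by linarith
    have "(real j + real i + 2 + e) * ((real (Suc j) + real (Suc i) + 2 + e) * gmom (Suc (Suc (Suc i))) (Suc j))
        = (real j + real i + 2 + e) * ((real j + 1) * gmom (Suc (Suc i)) j)"
      using s1 s2 s3 by (simp del: of_nat_add) algebra
    then have "(real (Suc j) + real (Suc i) + 2 + e) * gmom (Suc (Suc (Suc i))) (Suc j)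
        = (real j + 1) * gmom (Suc (Suc i)) j"
      using pos by (metis less_numeral_extra(3) mult_left_cancel)
    then show ?thesis using 3 by (simp add: add_ac)
  qed
qed

lemma gmom_Suc_0: "gmom (Suc k) 0 = 0"
proof (induction k rule: induct_nat_012)
  case 0
  then show ?case using L_x by (simp add: monom_Suc monom_0)
next
  case 1
  \<comment> \<open>The skip factor j-k vanishes at j = k = 0; this starts the even degrees, and
    \<open>L_x\<close> starts the odd ones.\<close>
  have "(real 0 + real 0 + 2 + e) * gmom (Suc (Suc 0)) 0 = (real 0 - real 0) * gmom 0 0"
    by (rule gmom_shift_imp_skip) (rule gmom_shift)
  then show ?case using e_nonneg by simp
next
  case (ge2 k)
  have "(real 0 + real (Suc k) + 2 + e) * gmom (Suc (Suc (Suc k))) 0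
      = (real 0 - real (Suc k)) * gmom (Suc k) 0"
    by (rule gmom_shift_imp_skip) (rule gmom_shift)
  moreover have "real 0 + real (Suc k) + 2 + e \<noteq> 0" using e_nonneg by linarith
  ultimately show ?case using ge2 by auto
qed

text \<open>The shift relation lowers degree and exponent together until the exponent is 0 and the
  degree still positive.\<close>

lemma gmom_eq_0: "j < k \<Longrightarrow> gmom k j = 0"
proof (induction j arbitrary: k)
  case 0
  then show ?case using gmom_Suc_0 by (metis gr0_implies_Suc)
next
  case (Suc j)
  then obtain i where k: "k = Suc i" by (cases k) auto
  have "real j + real i + 2 + e \<noteq> 0" using e_nonneg by linarith
  then show ?case using gmom_shift[of j i] Suc k by auto
qed

lemma L_gegen_mult_eq_0:
  assumes "degree p < k"
  shows "L (gegen e k * p) = 0"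
proof -
  have "gegen e k * p = gegen e k * (\<Sum>i\<le>degree p. monom (coeff p i) i)"
    by (simp only: poly_as_sum_of_monoms)
  also have "\<dots> = (\<Sum>i\<le>degree p. smult (coeff p i) (gegen e k * monom 1 i))"
    by (simp add: sum_distrib_left smult_monom flip: mult_smult_right)
  finally show ?thesis
    using assms by (simp add: L_sum L_smult gmom_eq_0)
qed

lemma L_gegen: "k \<ge> 1 \<Longrightarrow> L (gegen e k) = 0"
  using L_gegen_mult_eq_0[of 1 k] by simp

lemma L_gegen_orthogonal:
  assumes "k \<noteq> l"
  shows "L (gegen e k * gegen e l) = 0"
proof (cases "k < l")
  case True
  then show ?thesis
    using L_gegen_mult_eq_0[of "gegen e k" l] degree_gegen[of e k] by (simp add: mult.commute)
next
  case False
  then show ?thesis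
    using L_gegen_mult_eq_0[of "gegen e l" k] degree_gegen[of e l] assms by simp
qed

lemma L_gegen_norm_1: "(2 + e) * L (gegen e 1 * gegen e 1) = 1"
proof -
  have "gegen e 1 * gegen e 1 = monom 1 (0 + 2)"
    by (simp add: monom_Suc numeral_2_eq_2 monom_0)
  then show ?thesis using L_moment[of 0] L_one by (simp add: monom_0 one_pCons)
qed

text \<open>The mixed value L(t R_{k+1} R_{k+2}) is computed twice, by expanding R_{k+2} and by
  expanding R_{k+3} with the recurrence. Each time orthogonality removes one term and leaves a
  squared norm.\<close>

lemma L_gegen_norm_Suc:
  "(real k + 1 + e) * (2 * (real k + 2) + e) * L (gegen e (Suc (Suc k)) * gegen e (Suc (Suc k)))
    = (2 * (real k + 1) + e) * (real k + 2) * L (gegen e (Suc k) * gegen e (Suc k))"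
proof -
  let ?X = "[:0, 1:] * gegen e (Suc k) * gegen e (Suc (Suc k))"
  have "smult (real k + 1 + e) (gegen e (Suc (Suc k)) * gegen e (Suc (Suc k)))
      = smult (2 * (real k + 1) + e) ?X - smult (real k + 1) (gegen e k * gegen e (Suc (Suc k)))"
    unfolding mult_smult_left[symmetric] gegen_recurrence[OF e_nonneg]
    by (simp add: algebra_simps)
  then have 1: "(real k + 1 + e) * L (gegen e (Suc (Suc k)) * gegen e (Suc (Suc k)))
      = (2 * (real k + 1) + e) * L ?X"
    using L_gegen_orthogonal[of k "Suc (Suc k)"] by (metis L_diff L_smult diff_zero mult_zero_right n_not_Suc_n less_Suc_eq nat_neq_iff)
  have "smult (real (Suc k) + 1 + e) (gegen e (Suc (Suc (Suc k))) * gegen e (Suc k))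
      = smult (2 * (real (Suc k) + 1) + e) ?X - smult (real (Suc k) + 1) (gegen e (Suc k) * gegen e (Suc k))"
    unfolding mult_smult_left[symmetric] gegen_recurrence[OF e_nonneg]
    by (simp add: algebra_simps)
  then have "(2 * (real (Suc k) + 1) + e) * L ?X = (real (Suc k) + 1) * L (gegen e (Suc k) * gegen e (Suc k))"
    using L_gegen_orthogonal[of "Suc (Suc (Suc k))" "Suc k"]
    by (metis L_diff L_smult eq_iff_diff_eq_0 mult_zero_right n_not_Suc_n less_Suc_eq nat_neq_iff)
  then have 2: "(2 * (real k + 2) + e) * L ?X = (real k + 2) * L (gegen e (Suc k) * gegen e (Suc k))"
    by (simp add: algebra_simps)
  show ?thesis using 1 2 by algebra
qed

end

section \<open>Zonal harmonics\<close>

text \<open>Signed coefficient of t^(k-2j) in the classical Gegenbauer polynomial C_k^l. The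
  Pochhammer symbol stands for Gamma(k-j+l)/Gamma(l) and keeps the recurrences rational; the value 0
  out of range lets sums be extended to a common upper limit.\<close>

definition geg_term :: "real \<Rightarrow> nat \<Rightarrow> nat \<Rightarrow> real" where
  "geg_term l k j = (if 2 * j \<le> k
     then (-1) ^ j * 2 ^ (k - 2 * j) * pochhammer l (k - j) / (fact j * fact (k - 2 * j)) else 0)"

lemma geg_term_rec_0:
  "(real k + 2) * geg_term l (Suc (Suc k)) 0 = 2 * (real k + 1 + l) * geg_term l (Suc k) 0"
proof -
  have "(real k + 2) / fact (Suc (Suc k)) = (1::real) / fact (Suc k)"
    by (simp add: divide_simps)
  moreover have "pochhammer l (Suc (Suc k)) = pochhammer l (Suc k) * (real k + 1 + l)"
    by (simp only: pochhammer_Suc[of l "Suc k"]) simp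
  moreover have "(real k + 2) * geg_term l (Suc (Suc k)) 0
      = (real k + 2) / fact (Suc (Suc k)) * (2 ^ Suc (Suc k) * pochhammer l (Suc (Suc k)))"
    by (simp add: geg_term_def del: fact_Suc)
  ultimately show ?thesis
    by (simp add: geg_term_def del: fact_Suc)
qed

text \<open>Coefficient comparison in (k+2) C_{k+2} = 2(k+1+l) t C_{k+1} - (k+2l) C_k. At 2j = k the
  constant term of C_{k+2} is compared, which t C_{k+1} lacks.\<close>

lemma geg_term_rec_Suc:
  "(real k + 2) * geg_term l (Suc (Suc k)) (Suc j) =
     2 * (real k + 1 + l) * geg_term l (Suc k) (Suc j) - (real k + 2 * l) * geg_term l k j"
proof -
  consider "2 * j < k" | "2 * j = k" | "2 * j > k" by linarith
  then show ?thesis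
  proof cases
    case 1
    define a where "a = k - 2 * j - 1"
    have k: "k = 2 * j + a + 1" using 1 by (simp add: a_def)
    have s: "Suc (Suc k) - 2 * Suc j = Suc a" "Suc k - 2 * Suc j = a" "k - 2 * j = Suc a"
      "Suc (Suc k) - Suc j = Suc (j + a + 1)" "Suc k - Suc j = j + a + 1" "k - j = j + a + 1"
      using k by auto
    have d: "2 * Suc j \<le> Suc (Suc k)" "2 * Suc j \<le> Suc k" "2 * j \<le> k" using k by auto
    define P where "P = pochhammer l (j + a + 1)"
    have P: "pochhammer l (Suc (j + a + 1)) = P * (l + (real j + real a + 1))"
      unfolding P_def pochhammer_Suc by simp
    have f: "fact (Suc a) = (real a + 1) * fact a" "fact (Suc j) = (real j + 1) * fact j" by simp_all
    have "real k = 2 * real j + real a + 1" using k by simp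
    then show ?thesis
      unfolding geg_term_def s d if_True P f P_def[symmetric] power_Suc
      by (simp add: divide_simps del: fact_Suc) (simp add: algebra_simps)
  next
    case 2
    have "geg_term l (Suc (Suc k)) (Suc j) = - ((-1) ^ j * (pochhammer l j * (l + real j)) / (fact j * (real j + 1)))"
      using 2 by (auto simp: geg_term_def pochhammer_Suc divide_simps)
    moreover have "geg_term l (Suc k) (Suc j) = 0" "geg_term l k j = (-1) ^ j * pochhammer l j / fact j"
      using 2 by (auto simp: geg_term_def)
    moreover have "real k = 2 * real j" using 2 by simp
    ultimately show ?thesis
      by (simp only: mult_zero_right diff_0) (simp add: divide_simps, simp add: algebra_simps)
  next
    case 3
    then show ?thesis by (simp add: geg_term_def)
  qed
qed

definition geg_sum :: "real \<Rightarrow> nat \<Rightarrow> real \<Rightarrow> real" where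
  "geg_sum l k t = (\<Sum>j = 0..k div 2. geg_term l k j * t ^ (k - 2 * j))"

lemma geg_sum_extend:
  assumes "N \<ge> k div 2"
  shows "geg_sum l k t = (\<Sum>j = 0..N. geg_term l k j * t ^ (k - 2 * j))"
  unfolding geg_sum_def
  by (rule sum.mono_neutral_left) (use assms in \<open>auto simp: geg_term_def\<close>)

lemma geg_sum_rec:
  "(real k + 2) * geg_sum l (Suc (Suc k)) t =
     2 * (real k + 1 + l) * (t * geg_sum l (Suc k) t) - (real k + 2 * l) * geg_sum l k t"
proof -
  have split: "(\<Sum>j = 0..Suc k. f j) = f 0 + (\<Sum>j = 0..k. f (Suc j))" for f :: "nat \<Rightarrow> real"
    by (simp add: sum.atLeast_Suc_atMost sum.shift_bounds_cl_Suc_ivl del: sum.cl_ivl_Suc)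
  \<comment> \<open>Subtraction of naturals truncates, so the exponents match only in range; out of
    range the coefficient is 0.\<close>
  have t: "t * (geg_term l (Suc k) (Suc j) * t ^ (Suc k - 2 * Suc j)) =
      geg_term l (Suc k) (Suc j) * t ^ (k - 2 * j)" for j
  proof (cases "2 * Suc j \<le> Suc k")
    case True
    then have "k - 2 * j = Suc (Suc k - 2 * Suc j)" by auto
    then show ?thesis by simp
  qed (simp add: geg_term_def)
  have "(real k + 2) * geg_sum l (Suc (Suc k)) t
      = (\<Sum>j = 0..Suc k. (real k + 2) * geg_term l (Suc (Suc k)) j * t ^ (Suc (Suc k) - 2 * j))"
    by (subst geg_sum_extend[of _ "Suc k"]) (auto simp: sum_distrib_left mult.assoc simp del: sum.cl_ivl_Suc)
  also have "\<dots> = 2 * (real k + 1 + l) * geg_term l (Suc k) 0 * t ^ Suc (Suc k)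
      + (\<Sum>j = 0..k. (2 * (real k + 1 + l) * geg_term l (Suc k) (Suc j) - (real k + 2 * l) * geg_term l k j) * t ^ (k - 2 * j))"
    unfolding split geg_term_rec_0 geg_term_rec_Suc by simp
  also have "\<dots> = 2 * (real k + 1 + l) * (t * (\<Sum>j = 0..Suc k. geg_term l (Suc k) j * t ^ (Suc k - 2 * j)))
       - (real k + 2 * l) * (\<Sum>j = 0..k. geg_term l k j * t ^ (k - 2 * j))"
    unfolding split distrib_left sum_distrib_left t
    by (simp add: sum_subtractf left_diff_distrib mult.assoc mult.left_commute)
  also have "\<dots> = 2 * (real k + 1 + l) * (t * geg_sum l (Suc k) t) - (real k + 2 * l) * geg_sum l k t"
    by (simp add: geg_sum_extend[of "Suc k" "Suc k"] geg_sum_extend[of k k] del: sum.cl_ivl_Suc)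
  finally show ?thesis .
qed

text \<open>The factor \<open>pochhammer (2 * l) k / fact k\<close> is the value C_k^l(1). Once it
  is divided out, the recurrence of C_k^l becomes that of \<open>gegen\<close> with e = 2l.\<close>

lemma geg_sum_eq_gegen:
  assumes "l > 0"
  shows "geg_sum l k t = pochhammer (2 * l) k / fact k * poly (gegen (2 * l) k) t"
proof (induction k rule: induct_nat_012)
  case 0
  then show ?case by (simp add: geg_sum_def geg_term_def)
next
  case 1
  then show ?case by (simp add: geg_sum_def geg_term_def)
next
  case (ge2 k)
  define G where "G = pochhammer (2 * l) k / fact k"
  have G1: "pochhammer (2 * l) (Suc k) / fact (Suc k) = G * (2 * l + k) / (real k + 1)"
    by (simp add: G_def pochhammer_Suc field_simps)
  have G2: "pochhammer (2 * l) (Suc (Suc k)) / fact (Suc (Suc k))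
      = G * (2 * l + k) / (real k + 1) * (2 * l + k + 1) / (real k + 2)"
    by (simp add: G_def pochhammer_Suc field_simps)
  have "2 * l \<ge> 0" using assms by simp
  note rec = poly_gegen_recurrence[OF this, of k t]
  have "(real k + 2) * geg_sum l (Suc (Suc k)) t =
     2 * (real k + 1 + l) * (t * (G * (2 * l + k) / (real k + 1) * poly (gegen (2 * l) (Suc k)) t))
       - (real k + 2 * l) * (G * poly (gegen (2 * l) k) t)"
    unfolding geg_sum_rec ge2 G1 by (simp add: G_def)
  also have "\<dots> = G * (2 * l + k) / (real k + 1) *
      ((2 * (real k + 1) + 2 * l) * (t * poly (gegen (2 * l) (Suc k)) t) - (real k + 1) * poly (gegen (2 * l) k) t)"
  proof -
    define H where "H = G / (real k + 1)"
    have "G = H * (real k + 1)" by (simp add: H_def)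
    moreover have "G * (2 * l + real k) / (real k + 1) = (2 * l + real k) * H" by (simp add: H_def)
    ultimately show ?thesis by (simp only:) (simp add: algebra_simps)
  qed
  also have "\<dots> = (real k + 2) * (G * (2 * l + k) / (real k + 1) * (2 * l + k + 1) / (real k + 2) * poly (gegen (2 * l) (Suc (Suc k))) t)"
    unfolding rec[symmetric] by (simp add: add_ac)
  finally show ?case unfolding G2 by (subst (asm) mult_left_cancel) auto
qed

section \<open>Dimensions of the spaces of spherical harmonics\<close>

lemma dim_harm_eq:
  assumes "k \<ge> 1"
  shows "real (dim_harm (e + 2) k) = (2 * real k + real e) / real k * real ((e + k - 1) choose e)"
proof -
  obtain i where k: "k = Suc i" using assms by (cases k) auto
  \<comment> \<open>Absorption makes the two binomials in \<open>dim_harm\<close> proportional, so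
    their sum becomes a single product.\<close>
  have "Suc i * ((e + k) choose e) = (e + k) * ((e + i) choose e)"
    using binomial_absorb_comp[of "e + k" e] k by simp
  then have "real k * real ((e + k) choose e) = (real e + real k) * real ((e + i) choose e)"
    using k by (metis of_nat_add of_nat_mult)
  then show ?thesis using k by (simp add: dim_harm_def field_simps)
qed

lemma dim_harm_1: "real (dim_harm (e + 2) 1) = real e + 2"
  using dim_harm_eq[of 1 e] by simp

lemma dim_harm_Suc:
  assumes "k \<ge> 1"
  shows "(2 * real k + real e) * (real k + 1) * real (dim_harm (e + 2) (Suc k)) =
    (2 * real k + 2 + real e) * (real k + real e) * real (dim_harm (e + 2) k)"
proof -
  obtain i where k: "k = Suc i" using assms by (cases k) auto
  have "Suc i * ((e + k) choose e) = (e + k) * ((e + i) choose e)"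
    using binomial_absorb_comp[of "e + k" e] k by simp
  then have *: "real k * real ((e + k) choose e) = (real e + real k) * real ((e + i) choose e)"
    using k by (metis of_nat_add of_nat_mult)
  have "real (dim_harm (e + 2) (Suc k)) = (2 * (real k + 1) + real e) / (real k + 1) * real ((e + k) choose e)"
    using dim_harm_eq[of "Suc k" e] by (simp add: add_ac)
  moreover have "real (dim_harm (e + 2) k) = (2 * real k + real e) / real k * real ((e + i) choose e)"
    using dim_harm_eq[of k e] k by simp
  moreover have "real k > 0" using k by simp
  ultimately have "real k * real (dim_harm (e + 2) k) = (2 * real k + real e) * real ((e + i) choose e)"
    "(real k + 1) * real (dim_harm (e + 2) (Suc k)) = (2 * (real k + 1) + real e) * real ((e + k) choose e)"
    by simp_all
  then have "real k * ((2 * real k + real e) * (real k + 1) * real (dim_harm (e + 2) (Suc k))) =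
      real k * ((2 * real k + 2 + real e) * (real k + real e) * real (dim_harm (e + 2) k))"
    using * by algebra
  then show ?thesis using \<open>real k > 0\<close> by simp
qed

text \<open>This identifies the constant relating h_k to R_k: 1 + 2k/e is the prefactor in
  \<open>sobolev_h\<close>, and (e)_k / k! is the value at 1 of the Gegenbauer polynomial with
  parameter e/2.\<close>

lemma dim_harm_eq_pochhammer:
  assumes "k \<ge> 1" "e > 0"
  shows "real (dim_harm (e + 2) k) = (1 + 2 * real k / real e) * (pochhammer (real e) k / fact k)"
  using assms
proof (induction k rule: nat_induct_at_least)
  case base
  then show ?case using dim_harm_1[of e] by (simp add: field_simps)
next
  case (Suc k)
  have "(2 * real k + real e) * (real k + 1) * real (dim_harm (e + 2) (Suc k)) =
    (2 * real k + 2 + real e) * (real k + real e) * ((1 + 2 * real k / real e) * (pochhammer (real e) k / fact k))"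
    using dim_harm_Suc[OF Suc(1), of e] Suc by simp
  also have "\<dots> = (2 * real k + real e) * (real k + 1) *
    ((1 + 2 * real (Suc k) / real e) * (pochhammer (real e) (Suc k) / fact (Suc k)))"
  proof -
    define P where "P = pochhammer (real e) k / fact k"
    have P: "pochhammer (real e) (Suc k) / fact (Suc k) = P * (real k + real e) / (real k + 1)"
      by (simp add: P_def pochhammer_Suc field_simps)
    have "1 + 2 * real k / real e = (2 * real k + real e) / real e"
      "1 + 2 * real (Suc k) / real e = (2 * real k + 2 + real e) / real e"
      using Suc(3) by (simp_all add: field_simps)
    then show ?thesis unfolding P P_def[symmetric] by simp
  qed
  finally have "((2 * real k + real e) * (real k + 1)) * real (dim_harm (e + 2) (Suc k)) =
    ((2 * real k + real e) * (real k + 1)) *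
    ((1 + 2 * real (Suc k) / real e) * (pochhammer (real e) (Suc k) / fact (Suc k)))" .
  moreover have "(2 * real k + real e) * (real k + 1) \<noteq> 0"
    using Suc(1) by (intro no_zero_divisors) auto
  ultimately show ?case by (metis mult_left_cancel)
qed

lemma poly_gegen_cos: "poly (gegen 0 k) (cos \<phi>) = cos (real k * \<phi>)"
proof (induction k rule: induct_nat_012)
  case (ge2 k)
  have "(real k + 1) * poly (gegen 0 (Suc (Suc k))) (cos \<phi>) =
      (real k + 1) * (2 * cos \<phi> * cos ((real k + 1) * \<phi>) - cos (real k * \<phi>))"
    using poly_gegen_recurrence[of 0 k "cos \<phi>"] ge2 by (simp add: algebra_simps)
  then have "poly (gegen 0 (Suc (Suc k))) (cos \<phi>) =
      2 * cos \<phi> * cos ((real k + 1) * \<phi>) - cos (real k * \<phi>)"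
    by (subst (asm) mult_left_cancel) auto
  also have "cos (real k * \<phi>) = cos ((real k + 1) * \<phi> - \<phi>)"
    by (simp add: algebra_simps)
  also have "2 * cos \<phi> * cos ((real k + 1) * \<phi>) - \<dots> = cos ((real k + 1) * \<phi> + \<phi>)"
    unfolding cos_add cos_diff by simp
  also have "\<dots> = cos (real (Suc (Suc k)) * \<phi>)"
    by (simp add: algebra_simps)
  finally show ?case .
qed auto

lemma sobolev_h_eq_gegen:
  assumes "k \<ge> 1" "\<bar>t\<bar> \<le> 1" "d \<ge> 2"
  shows "sobolev_h d k t = real (dim_harm d k) * poly (gegen (real d - 2) k) t"
proof (cases "d = 2")
  case True
  have "dim_harm d k = 2" using True assms by (simp add: dim_harm_def)
  moreover have "poly (gegen 0 k) t = cos (real k * arccos t)"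
    using poly_gegen_cos[of k "arccos t"] assms by (simp add: abs_le_iff cos_arccos_abs)
  ultimately show ?thesis using True by (simp add: sobolev_h_def)
next
  case False
  define e where "e = d - 2"
  have d: "d = e + 2" and e: "e > 0" using False assms by (auto simp: e_def)
  define l where "l = (real d - 2) / 2"
  have l: "l > 0" and l2: "2 * l = real e" using e d by (simp_all add: l_def)
  have *: "(-1) ^ j * gegenbauer_coeff l k j = geg_term l k j" if "j \<in> {0..k div 2}" for j
  proof -
    have j: "2 * j \<le> k" using that by auto
    have "pochhammer l (k - j) = Gamma (l + of_nat (k - j)) / Gamma l"
      by (rule pochhammer_Gamma) (use l in \<open>auto simp: nonpos_Ints_def\<close>)
    moreover have "real k - real j + l = l + of_nat (k - j)"
      using j by (simp add: of_nat_diff)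
    ultimately have "Gamma (real k - real j + l) = pochhammer l (k - j) * Gamma l"
      using Gamma_real_pos[OF l] by (simp only: nonzero_eq_divide_eq)
    then show ?thesis
      using j Gamma_real_pos[OF l] by (simp add: gegenbauer_coeff_def geg_term_def)
  qed
  have "(\<Sum>j = 0..k div 2. (-1) ^ j * gegenbauer_coeff l k j * t ^ (k - 2 * j)) = geg_sum l k t"
    unfolding geg_sum_def by (intro sum.cong refl) (simp only: *)
  also have "\<dots> = pochhammer (real e) k / fact k * poly (gegen (real e) k) t"
    using geg_sum_eq_gegen[OF l, of k t] by (simp only: l2)
  finally have "sobolev_h d k t = (1 + 2 * real k / real e) * (pochhammer (real e) k / fact k * poly (gegen (real e) k) t)"
    using False d by (simp add: sobolev_h_def l_def)
  then show ?thesis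
    using dim_harm_eq_pochhammer[OF assms(1) e] d by simp
qed

text \<open>The recurrences for the dimensions and for the squared norms have reciprocal ratios, so
  the product keeps its value at degree 1, which is (m+2) times 1/(m+2).\<close>

lemma (in gegenbauer_functional) dim_harm_L_gegen_square:
  assumes "k \<ge> 1" "e = real m"
  shows "real (dim_harm (m + 2) k) * L (gegen e k * gegen e k) = 1"
  using assms(1)
proof (induction k rule: nat_induct_at_least)
  case base
  then show ?case using L_gegen_norm_1 dim_harm_1[of m] assms(2) by (simp add: add.commute)
next
  case (Suc k)
  obtain i where k: "k = Suc i" using Suc by (cases k) auto
  let ?N = "\<lambda>k. L (gegen e k * gegen e k)"
  have 1: "(real k + e) * (2 * real k + 2 + e) * ?N (Suc k) = (2 * real k + e) * (real k + 1) * ?N k"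
    using L_gegen_norm_Suc[of i] k by (simp add: add_ac)
  have 2: "(2 * real k + e) * (real k + 1) * real (dim_harm (m + 2) (Suc k)) =
    (2 * real k + 2 + e) * (real k + e) * real (dim_harm (m + 2) k)"
    using dim_harm_Suc[of k m] k assms by simp
  let ?c = "(2 * real k + e) * (real k + 1)"
  have "?c * (real (dim_harm (m + 2) (Suc k)) * ?N (Suc k)) = ?c * (real (dim_harm (m + 2) k) * ?N k)"
    using 1 2 by algebra
  moreover have "?c \<noteq> 0" using k e_nonneg by (intro no_zero_divisors) auto
  ultimately show ?case using Suc by (metis mult_left_cancel)
qed

section \<open>Zonal moments of the uniform distribution\<close>

lemma lborel_distr_orthogonal:
  fixes T :: "real^'d \<Rightarrow> real^'d"
  assumes T: "orthogonal_transformation T"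
  shows "distr lborel borel T = lborel"
proof -
  \<comment> \<open>Uniqueness of translation invariant measures: both \<open>\<lambda>(T\<^sup>-\<^sup>1 A) \<lambda>(B)\<close> and
    \<open>\<lambda>(A) \<lambda>(T\<^sup>-\<^sup>1 B)\<close> are the integral of \<open>1\<^sub>A(T x) 1\<^sub>B(y + T x)\<close> over \<open>x\<close> and \<open>y\<close>;
    the ball \<open>B\<close> satisfies \<open>T\<^sup>-\<^sup>1 B = B\<close>.\<close>
  have lin: "linear T" using T by (rule orthogonal_transformation_linear)
  then have m[measurable]: "T \<in> borel_measurable borel"
    by (intro borel_measurable_continuous_onI linear_continuous_on) (simp add: linear_linear)
  have mball: "emeasure lborel (ball (0::real^'d) 1) \<noteq> 0" "emeasure lborel (ball (0::real^'d) 1) \<noteq> \<infinity>"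
  proof -
    have "unit_ball_vol (real CARD('d)) > 0" by simp
    then show "emeasure lborel (ball (0::real^'d) 1) \<noteq> 0"
      by (simp add: emeasure_ball less_le)
    show "emeasure lborel (ball (0::real^'d) 1) \<noteq> \<infinity>"
      using emeasure_lborel_ball_finite[of "0::real^'d" 1] by auto
  qed
  have shift: "(\<integral>\<^sup>+y. f (c + y) \<partial>lborel) = (\<integral>\<^sup>+y. f y \<partial>lborel)"
    if [measurable]: "f \<in> borel_measurable borel" for f :: "real^'d \<Rightarrow> ennreal" and c
  proof -
    have "(\<integral>\<^sup>+y. f y \<partial>distr lborel borel ((+) c)) = (\<integral>\<^sup>+y. f (c + y) \<partial>lborel)"
      by (rule nn_integral_distr) measurable
    then show ?thesis unfolding lborel_distr_plus by (rule sym)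
  qed
  have reflect: "(\<integral>\<^sup>+y. f (- y) \<partial>lborel) = (\<integral>\<^sup>+y. f y \<partial>lborel)"
    if [measurable]: "f \<in> borel_measurable borel" for f :: "real^'d \<Rightarrow> ennreal"
  proof -
    have "lborel = distr lborel borel (\<lambda>x::real^'d. - x)"
      using lborel_affine[of "-1" "0::real^'d"] by (simp add: density_1)
    moreover have "(\<integral>\<^sup>+y. f y \<partial>distr lborel borel (\<lambda>x::real^'d. - x)) = (\<integral>\<^sup>+y. f (- y) \<partial>lborel)"
      by (rule nn_integral_distr) measurable
    ultimately show ?thesis by metis
  qed
  show ?thesis
  proof (rule measure_eqI)
    fix A assume "A \<in> sets (distr lborel borel T)"
    then have [measurable]: "A \<in> sets borel" by simp
    define a b :: "real^'d \<Rightarrow> ennreal" where "a = indicator A" and "b = indicator (ball 0 1)"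
    have [measurable]: "a \<in> borel_measurable borel" "b \<in> borel_measurable borel"
      unfolding a_def b_def by (auto intro!: borel_measurable_indicator borel_open)
    have inta: "(\<integral>\<^sup>+x. a x \<partial>M) = emeasure M A" if "sets M = sets borel" for M
      unfolding a_def using that by (intro nn_integral_indicator) simp
    have intb: "(\<integral>\<^sup>+x. b x \<partial>lborel) = emeasure lborel (ball (0::real^'d) 1)"
      unfolding b_def by (intro nn_integral_indicator) (simp add: borel_open)
    have Tb: "b (T x) = b x" for x
      using orthogonal_transformation_norm[OF T] by (simp add: b_def indicator_def)
    \<comment> \<open>With T z = y, translating x by z turns T x into y + T x, so \<open>y\<close>
      moves from the factor \<open>b\<close> to the factor \<open>a\<close>.\<close>
    have inner: "(\<integral>\<^sup>+x. a (T x) * b (y + T x) \<partial>lborel) = (\<integral>\<^sup>+x. a (T x - y) * b (T x) \<partial>lborel)" for y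
    proof -
      obtain z where z: "T z = y"
        using orthogonal_transformation_surj[OF T] by (metis surjD)
      have "(\<integral>\<^sup>+x. a (T x) * b (y + T x) \<partial>lborel) = (\<integral>\<^sup>+x. a (T (z + x) - y) * b (T (z + x)) \<partial>lborel)"
        by (simp add: linear_add[OF lin] z)
      also have "\<dots> = (\<integral>\<^sup>+x. a (T x - y) * b (T x) \<partial>lborel)"
        by (rule shift) measurable
      finally show ?thesis .
    qed
    have "emeasure (distr lborel borel T) A * emeasure lborel (ball (0::real^'d) 1)
        = (\<integral>\<^sup>+x. a (T x) * (\<integral>\<^sup>+y. b y \<partial>lborel) \<partial>lborel)"
    proof -
      have "emeasure (distr lborel borel T) A = (\<integral>\<^sup>+x. a x \<partial>distr lborel borel T)"
        by (simp add: inta)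
      also have "\<dots> = (\<integral>\<^sup>+x. a (T x) \<partial>lborel)"
        by (rule nn_integral_distr) measurable
      moreover have "(\<integral>\<^sup>+x. a (T x) * (\<integral>\<^sup>+y. b y \<partial>lborel) \<partial>lborel)
          = (\<integral>\<^sup>+x. a (T x) \<partial>lborel) * (\<integral>\<^sup>+y. b y \<partial>lborel)"
        by (rule nn_integral_multc) measurable
      ultimately show ?thesis by (simp add: intb)
    qed
    also have "\<dots> = (\<integral>\<^sup>+x. \<integral>\<^sup>+y. a (T x) * b (y + T x) \<partial>lborel \<partial>lborel)"
    proof (rule nn_integral_cong)
      fix x
      show "a (T x) * (\<integral>\<^sup>+y. b y \<partial>lborel) = (\<integral>\<^sup>+y. a (T x) * b (y + T x) \<partial>lborel)"
        using shift[of b "T x"] by (simp add: nn_integral_cmult add.commute[of _ "T x"])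
    qed
    also have "\<dots> = (\<integral>\<^sup>+y. \<integral>\<^sup>+x. a (T x) * b (y + T x) \<partial>lborel \<partial>lborel)"
      by (rule lborel_pair.Fubini') measurable
    also have "\<dots> = (\<integral>\<^sup>+y. \<integral>\<^sup>+x. a (T x - y) * b (T x) \<partial>lborel \<partial>lborel)"
      by (simp only: inner)
    also have "\<dots> = (\<integral>\<^sup>+x. \<integral>\<^sup>+y. a (T x - y) * b (T x) \<partial>lborel \<partial>lborel)"
      by (rule lborel_pair.Fubini') measurable
    also have "\<dots> = (\<integral>\<^sup>+x. emeasure lborel A * b x \<partial>lborel)"
    proof (rule nn_integral_cong)
      fix x
      have "(\<integral>\<^sup>+y. a (T x - y) \<partial>lborel) = (\<integral>\<^sup>+y. a (T x + y) \<partial>lborel)"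
        using reflect[of "\<lambda>y. a (T x + y)"] by simp
      also have "\<dots> = emeasure lborel A" by (simp add: shift inta)
      finally show "(\<integral>\<^sup>+y. a (T x - y) * b (T x) \<partial>lborel) = emeasure lborel A * b x"
        by (simp add: nn_integral_multc Tb)
    qed
    also have "\<dots> = emeasure lborel A * emeasure lborel (ball (0::real^'d) 1)"
      by (simp add: nn_integral_cmult intb)
    finally show "emeasure (distr lborel borel T) A = emeasure lborel A"
      using mball by (subst (asm) (1 2) mult.commute) (auto simp: ennreal_mult_cancel_left)
  qed simp
qed

lemma sgn_borel_measurable [measurable]: "(sgn :: real^'d \<Rightarrow> real^'d) \<in> borel_measurable borel"
  unfolding sgn_div_norm by measurable

lemma uniform_ball_distr_orthogonal:
  fixes T :: "real^'d \<Rightarrow> real^'d"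
  assumes T: "orthogonal_transformation T"
  shows "distr (uniform_measure lborel (ball 0 1)) borel T = uniform_measure lborel (ball 0 1)"
proof (rule measure_eqI)
  have m[measurable]: "T \<in> borel_measurable borel"
    using orthogonal_transformation_linear[OF T]
    by (intro borel_measurable_continuous_onI linear_continuous_on) (simp add: linear_linear)
  fix A assume "A \<in> sets (distr (uniform_measure lborel (ball 0 1)) borel T)"
  then have A[measurable]: "A \<in> sets borel" by simp
  have vA: "T -` A \<in> sets borel"
    using measurable_sets_borel[OF m A] .
  have "ball 0 1 \<inter> T -` A = T -` (ball 0 1 \<inter> A)"
    using orthogonal_transformation_norm[OF T] by auto
  then have "emeasure lborel (ball 0 1 \<inter> T -` A) = emeasure (distr lborel borel T) (ball 0 1 \<inter> A)"
    by (subst emeasure_distr) auto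
  then show "emeasure (distr (uniform_measure lborel (ball 0 1)) borel T) A
      = emeasure (uniform_measure lborel (ball 0 1)) A"
    using vA by (subst emeasure_distr) (auto simp: lborel_distr_orthogonal[OF T])
qed simp

text \<open>Being linear and norm preserving, \<open>T\<close> commutes with \<open>sgn\<close>, so
  invariance passes from the ball to its radial projection. The indicator of the sphere, itself
  invariant, translates between the restricted space and the full one.\<close>

lemma integral_uniform_sphere_orthogonal:
  fixes T :: "real^'d \<Rightarrow> real^'d" and f :: "real^'d \<Rightarrow> real"
  assumes T: "orthogonal_transformation T" and f[measurable]: "f \<in> borel_measurable borel"
  shows "(\<integral>u. f (T u) \<partial>uniform_sphere) = (\<integral>u. f u \<partial>uniform_sphere)"
proof -
  let ?U = "uniform_measure lborel (ball 0 1) :: (real^'d) measure"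
  let ?D = "distr ?U borel sgn"
  let ?g = "\<lambda>u. indicator (sphere 0 1) u *\<^sub>R f u"
  have lin: "linear T" using T by (rule orthogonal_transformation_linear)
  then have m[measurable]: "T \<in> borel_measurable borel"
    by (intro borel_measurable_continuous_onI linear_continuous_on) (simp add: linear_linear)
  have comm: "T (sgn x) = sgn (T x)" for x
    using orthogonal_transformation_norm[OF T] linear_scale[OF lin] by (simp add: sgn_div_norm)
  have inv: "distr ?D borel T = ?D"
  proof -
    have "distr ?D borel T = distr ?U borel (T \<circ> sgn)"
      by (rule distr_distr) simp_all
    also have "T \<circ> sgn = sgn \<circ> T" using comm by auto
    also have "distr ?U borel (sgn \<circ> T) = distr (distr ?U borel T) borel sgn"
      by (rule distr_distr[symmetric]) simp_all
    finally show ?thesis by (simp add: uniform_ball_distr_orthogonal[OF T])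
  qed
  have "(\<integral>u. f (T u) \<partial>uniform_sphere) = (\<integral>u. indicator (sphere 0 1) u *\<^sub>R f (T u) \<partial>?D)"
    unfolding uniform_sphere_def by (rule integral_restrict_space) simp
  also have "\<dots> = (\<integral>u. ?g (T u) \<partial>?D)"
    using orthogonal_transformation_norm[OF T] by (intro Bochner_Integration.integral_cong) (auto simp: indicator_def)
  also have "\<dots> = (\<integral>u. ?g u \<partial>distr ?D borel T)"
  proof (rule integral_distr[symmetric])
    have "sphere (0::real^'d) 1 \<in> sets borel" by (simp add: borel_closed)
    then show "?g \<in> borel_measurable borel"
      by (intro borel_measurable_scaleR borel_measurable_indicator f)
  qed simp
  also have "\<dots> = (\<integral>u. f u \<partial>uniform_sphere)"
    unfolding inv uniform_sphere_def by (rule integral_restrict_space[symmetric]) simp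
  finally show ?thesis .
qed

section \<open>Zonal integrals and moments of a single coordinate\<close>

lemma space_uniform_sphere: "space uniform_sphere = sphere 0 1"
  by (simp add: uniform_sphere_def space_restrict_space)

lemma borel_measurable_uniform_sphere:
  "f \<in> borel_measurable borel \<Longrightarrow> f \<in> borel_measurable uniform_sphere"
  unfolding uniform_sphere_def by (rule measurable_restrict_space1) simp

lemma integrable_uniform_sphere_continuous:
  fixes f :: "real^'d \<Rightarrow> real"
  assumes "continuous_on UNIV f"
  shows "integrable uniform_sphere f"
proof -
  interpret prob_space "uniform_sphere :: (real^'d) measure" by (rule prob_space_uniform_sphere)
  have "compact (f ` sphere 0 1)"
    using assms by (intro compact_continuous_image continuous_on_subset[OF assms]) auto
  then have "bounded (f ` sphere 0 1)" by (rule compact_imp_bounded)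
  then obtain B where "\<forall>y \<in> f ` sphere 0 1. norm y \<le> B"
    unfolding bounded_iff by blast
  then have "norm (f u) \<le> B" if "u \<in> sphere 0 1" for u using that by auto
  then show ?thesis
    using assms borel_measurable_continuous_onI[OF assms]
    by (intro integrable_const_bound[where B = B] AE_I2 borel_measurable_uniform_sphere)
      (auto simp: space_uniform_sphere)
qed

text \<open>The type argument fixes the dimension, which a functional on polynomials cannot show.
  The coordinate \<open>undefined\<close> is an arbitrary one; by rotation invariance any unit
  vector gives the same value.\<close>

definition zonal_mean :: "(real^'d) itself \<Rightarrow> real poly \<Rightarrow> real" where
  "zonal_mean _ p = (\<integral>u. poly p (u \<bullet> axis undefined 1) \<partial>(uniform_sphere :: (real^'d) measure))"

lemma integral_zonal:
  fixes y :: "real^'d"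
  assumes "norm y = 1"
  shows "(\<integral>u. poly p (u \<bullet> y) \<partial>uniform_sphere) = zonal_mean TYPE(real^'d) p"
proof -
  have "norm y = norm (axis undefined 1 :: real^'d)" using assms by (simp add: norm_axis_1)
  then obtain T where T: "orthogonal_transformation T" "T y = (axis undefined 1 :: real^'d)"
    by (rule orthogonal_transformation_exists)
  have "T u \<bullet> axis undefined 1 = u \<bullet> y" for u
  proof -
    have "T u \<bullet> T y = u \<bullet> y" using T(1) by (simp add: orthogonal_transformation_def)
    then show ?thesis by (simp only: T(2))
  qed
  moreover have "(\<lambda>u::real^'d. poly p (u \<bullet> axis undefined 1)) \<in> borel_measurable borel"
    by (intro borel_measurable_continuous_onI continuous_intros)
  ultimately show ?thesis
    using integral_uniform_sphere_orthogonal[OF T(1), of "\<lambda>u. poly p (u \<bullet> axis undefined 1)"]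
    by (simp add: zonal_mean_def)
qed

lemma coeff_2_power: "coeff ([:1, 0, 1:] ^ j) 2 = (real j :: real)"
proof (induction j)
  case (Suc j)
  have "coeff ([:1, 0, 1:] ^ j) 0 = (1 :: real)"
    by (simp add: coeff_0_power)
  then show ?case using Suc by (simp add: coeff_mult numeral_2_eq_2)
qed simp

text \<open>Compare the coefficients of \<open>s\<^sup>2\<close> in \<open>E (u\<^sub>a + s u\<^sub>b)\<^sup>n = (1 + s\<^sup>2)\<^sup>n\<^sup>/\<^sup>2 E u\<^sub>a\<^sup>n\<close>, which is
  rotation invariance.\<close>

lemma integral_uniform_sphere_mixed_moment:
  fixes a b :: "'d::finite"
  assumes "a \<noteq> b"
  shows "(2 * real j + 1) * (\<integral>u. (u $ a) ^ (2 * j) * (u $ b)^2 \<partial>(uniform_sphere :: (real^'d) measure))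
     = zonal_mean TYPE(real^'d) (monom 1 (2 * j + 2))"
proof -
  let ?M = "uniform_sphere :: (real^'d) measure"
  let ?n = "2 * j + 2"
  let ?m = "zonal_mean TYPE(real^'d) (monom 1 ?n)"
  define p where "p = (\<Sum>i\<le>?n. monom (real (?n choose i) * (\<integral>u. (u $ b) ^ i * (u $ a) ^ (?n - i) \<partial>?M)) i)"
  have int: "integrable ?M (\<lambda>u. (u $ b) ^ i * (u $ a) ^ k)" for i k
    by (intro integrable_uniform_sphere_continuous continuous_intros)
  have "poly p s = poly (smult ?m ([:1, 0, 1:] ^ (j + 1))) s" for s
  proof -
    let ?y = "axis a 1 + s *\<^sub>R axis b 1 :: real^'d"
    have y: "?y \<bullet> ?y = 1 + s\<^sup>2"
      using assms by (simp add: inner_simps inner_axis_axis power2_eq_square)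
    then have ny: "(norm ?y)\<^sup>2 = 1 + s\<^sup>2" by (simp add: power2_norm_eq_inner)
    then have pos: "norm ?y \<noteq> 0" by (metis power_zero_numeral sum_power2_eq_zero_iff one_power2 zero_neq_one)
    let ?z = "?y /\<^sub>R norm ?y"
    have "norm ?z = 1" using pos by simp
    have "poly p s = (\<Sum>i\<le>?n. (\<integral>u. real (?n choose i) * ((u $ b) ^ i * (u $ a) ^ (?n - i)) * s ^ i \<partial>?M))"
      by (simp add: p_def poly_sum poly_monom)
    also have "\<dots> = (\<integral>u. (\<Sum>i\<le>?n. real (?n choose i) * ((u $ b) ^ i * (u $ a) ^ (?n - i)) * s ^ i) \<partial>?M)"
      by (rule Bochner_Integration.integral_sum[symmetric])
        (intro integrable_mult_left integrable_mult_right int)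
    also have "\<dots> = (\<integral>u. norm ?y ^ ?n * poly (monom 1 ?n) (u \<bullet> ?z) \<partial>?M)"
    proof (rule Bochner_Integration.integral_cong)
      fix u :: "real^'d"
      have "(\<Sum>i\<le>?n. real (?n choose i) * ((u $ b) ^ i * (u $ a) ^ (?n - i)) * s ^ i)
         = (s * u $ b + u $ a) ^ ?n"
        unfolding binomial_ring by (intro sum.cong) (auto simp: power_mult_distrib mult_ac)
      also have "s * u $ b + u $ a = norm ?y * (u \<bullet> ?z)"
        using pos by (simp add: inner_simps inner_axis field_simps)
      finally show "(\<Sum>i\<le>?n. real (?n choose i) * ((u $ b) ^ i * (u $ a) ^ (?n - i)) * s ^ i)
         = norm ?y ^ ?n * poly (monom 1 ?n) (u \<bullet> ?z)"
        by (simp only: power_mult_distrib poly_monom mult_1)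
    qed simp
    also have "\<dots> = norm ?y ^ ?n * ?m"
      using integral_zonal[OF \<open>norm ?z = 1\<close>] by simp
    also have "norm ?y ^ ?n = (1 + s\<^sup>2) ^ (j + 1)"
      using ny by (metis distrib_left mult.right_neutral power_mult mult.commute)
    finally show ?thesis by (simp add: power2_eq_square mult.commute poly_power del: power_Suc)
  qed
  then have "p = smult ?m ([:1, 0, 1:] ^ (j + 1))"
    by (intro poly_eq_poly_eq_iff[THEN iffD1] ext)
  then have "coeff p 2 = ?m * (real j + 1)"
    by (metis coeff_smult coeff_2_power of_nat_Suc Suc_eq_plus1 add.commute)
  moreover have "coeff p 2 = real (?n choose 2) * (\<integral>u. (u $ b)^2 * (u $ a) ^ (2 * j) \<partial>?M)"
    unfolding p_def coeff_sum coeff_monom by (subst sum.delta) auto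
  \<comment> \<open>The factor j+1 is also the coefficient of s^2 in (1 + s^2)^(j+1); cancelling it
    leaves 2j+1.\<close>
  moreover have "real (?n choose 2) = (real j + 1) * (2 * real j + 1)"
    by (simp add: choose_two field_simps)
  ultimately have "(real j + 1) * ((2 * real j + 1) * (\<integral>u. (u $ b)^2 * (u $ a) ^ (2 * j) \<partial>?M)) = (real j + 1) * ?m"
    by (simp add: mult_ac)
  moreover have "real j + 1 \<noteq> 0" by linarith
  ultimately show ?thesis by (simp add: mult.commute)
qed

lemma norm_1_sum_squares:
  fixes u :: "real^'d"
  assumes "norm u = 1"
  shows "(\<Sum>i\<in>UNIV. (u $ i)\<^sup>2) = 1"
  using assms by (simp add: norm_vec_def L2_set_def)

text \<open>Multiply u_a^n by 1 = sum of all u_b^2. The term b = a is the moment of order n+2, and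
  each of the other d-1 terms is that moment divided by n+1, which adds up to (n+1+d-1)/(n+1) times
  it.\<close>

lemma zonal_mean_even_moment:
  "(real n + real CARD('d)) * zonal_mean TYPE(real^'d) (monom 1 (n + 2))
     = (real n + 1) * zonal_mean TYPE(real^'d) (monom 1 n)" if "even n"
proof -
  let ?M = "uniform_sphere :: (real^'d) measure"
  obtain j where n: "n = 2 * j" using \<open>even n\<close> by (elim evenE)
  let ?m = "\<lambda>n. zonal_mean TYPE(real^'d) (monom 1 n)"
  define a :: 'd where "a = undefined"
  have int: "integrable ?M (\<lambda>u. (u $ i) ^ k * (u $ b) ^ l)" for i b k l
    by (intro integrable_uniform_sphere_continuous continuous_intros)
  have m: "?m k = (\<integral>u. (u $ a) ^ k \<partial>?M)" for k
    by (simp add: zonal_mean_def poly_monom inner_axis a_def)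
  have "?m n = (\<integral>u. (\<Sum>b\<in>UNIV. (u $ a) ^ n * (u $ b)\<^sup>2) \<partial>?M)"
    unfolding m
    by (rule Bochner_Integration.integral_cong)
      (simp_all add: norm_1_sum_squares space_uniform_sphere flip: sum_distrib_left)
  also have "\<dots> = (\<Sum>b\<in>UNIV. \<integral>u. (u $ a) ^ n * (u $ b)\<^sup>2 \<partial>?M)"
    by (rule Bochner_Integration.integral_sum) (rule int)
  also have "\<dots> = (\<integral>u. (u $ a) ^ n * (u $ a)\<^sup>2 \<partial>?M) + (\<Sum>b\<in>UNIV - {a}. \<integral>u. (u $ a) ^ n * (u $ b)\<^sup>2 \<partial>?M)"
    by (subst sum.remove[of _ a]) auto
  also have "(\<integral>u. (u $ a) ^ n * (u $ a)\<^sup>2 \<partial>?M) = ?m (n + 2)"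
    unfolding m by (simp only: power_add)
  also have "(\<Sum>b\<in>UNIV - {a}. \<integral>u. (u $ a) ^ n * (u $ b)\<^sup>2 \<partial>?M)
      = (\<Sum>b\<in>UNIV - {a}. ?m (n + 2) / (real n + 1))"
    using integral_uniform_sphere_mixed_moment[of a _ j] n
    by (intro sum.cong) (auto simp: field_simps)
  also have "\<dots> = (real CARD('d) - 1) * (?m (n + 2) / (real n + 1))"
    by (simp add: card_Diff_singleton of_nat_diff Suc_leI)
  finally show ?thesis by (simp add: field_simps)
qed

lemma zonal_mean_odd_moment:
  assumes "odd n"
  shows "zonal_mean TYPE(real^'d) (monom 1 n) = 0"
proof -
  let ?y = "axis undefined 1 :: real^'d"
  have "(\<integral>u. poly (monom 1 n) (u \<bullet> - ?y) \<partial>uniform_sphere) = zonal_mean TYPE(real^'d) (monom 1 n)"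
    by (rule integral_zonal) (simp add: norm_axis_1)
  moreover have "(\<integral>u. poly (monom 1 n) (u \<bullet> - ?y) \<partial>uniform_sphere) = - zonal_mean TYPE(real^'d) (monom 1 n)"
    using assms by (simp add: zonal_mean_def poly_monom)
  ultimately show ?thesis by simp
qed

lemma gegenbauer_functional_zonal_mean:
  assumes "CARD('d) \<ge> 2"
  shows "gegenbauer_functional (real CARD('d) - 2) (zonal_mean TYPE(real^'d))"
proof
  interpret prob_space "uniform_sphere :: (real^'d) measure" by (rule prob_space_uniform_sphere)
  have int: "integrable (uniform_sphere :: (real^'d) measure) (\<lambda>u. poly p (u \<bullet> axis undefined 1))" for p
    by (intro integrable_uniform_sphere_continuous continuous_intros)
  show "real CARD('d) - 2 \<ge> 0" using assms by simp
  show "zonal_mean TYPE(real^'d) (p + q) = zonal_mean TYPE(real^'d) p + zonal_mean TYPE(real^'d) q" for p q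
    by (simp add: zonal_mean_def int)
  show "zonal_mean TYPE(real^'d) (smult c p) = c * zonal_mean TYPE(real^'d) p" for c p
    by (simp add: zonal_mean_def)
  show "zonal_mean TYPE(real^'d) 1 = 1"
    using prob_space by (simp add: zonal_mean_def)
  show "zonal_mean TYPE(real^'d) (monom 1 1) = 0"
    by (rule zonal_mean_odd_moment) simp
  show "(real n + 2 + (real CARD('d) - 2)) * zonal_mean TYPE(real^'d) (monom 1 (n + 2)) =
      (real n + 1) * zonal_mean TYPE(real^'d) (monom 1 n)" for n
    using zonal_mean_even_moment[of n, where 'd = 'd] zonal_mean_odd_moment[of n, where 'd = 'd]
      zonal_mean_odd_moment[of "n + 2", where 'd = 'd]
    by (cases "even n") auto
qed

section \<open>Second moments of the cross terms\<close>

text \<open>Fubini with coordinate \<open>i\<close> innermost: if integrating out one observation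
  gives the same constant for all values of the others, that constant is the expectation.\<close>

lemma integral_PiM_const_slice:
  fixes f :: "('i \<Rightarrow> 'a) \<Rightarrow> real"
  assumes "prob_space M" "finite I" "i \<in> I" "integrable (\<Pi>\<^sub>M i\<in>I. M) f"
    and slice: "\<And>x. x \<in> space (\<Pi>\<^sub>M i\<in>I - {i}. M) \<Longrightarrow> (\<integral>y. f (x(i := y)) \<partial>M) = c"
  shows "(\<integral>x. f x \<partial>(\<Pi>\<^sub>M i\<in>I. M)) = c"
proof -
  interpret prob_space M by fact
  interpret product_prob_space "\<lambda>_. M" "I - {i}" ..
  have I: "insert i (I - {i}) = I" using assms by auto
  have "(\<integral>x. f x \<partial>(\<Pi>\<^sub>M i\<in>insert i (I - {i}). M)) = (\<integral>x. (\<integral>y. f (x(i := y)) \<partial>M) \<partial>(\<Pi>\<^sub>M i\<in>I - {i}. M))"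
    by (rule product_integral_insert) (use assms I in auto)
  also have "\<dots> = (\<integral>x. c \<partial>(\<Pi>\<^sub>M i\<in>I - {i}. M))"
    by (rule Bochner_Integration.integral_cong) (auto simp: slice)
  also have "\<dots> = c"
    by (simp add: P.prob_space)
  finally show ?thesis unfolding I .
qed

lemma space_PiM_uniform_sphere:
  "x \<in> space (\<Pi>\<^sub>M i\<in>I. uniform_sphere) \<Longrightarrow> i \<in> I \<Longrightarrow> norm (x i) = 1"
  by (auto simp: space_PiM space_uniform_sphere PiE_def Pi_def)

lemma measurable_poly_inner:
  assumes "i \<in> I" "j \<in> I"
  shows "(\<lambda>x. poly p (x i \<bullet> x j)) \<in> borel_measurable (\<Pi>\<^sub>M i\<in>I. uniform_sphere :: (real^'d) measure)"
proof -
  have comp: "(\<lambda>x. x k) \<in> measurable (\<Pi>\<^sub>M i\<in>I. uniform_sphere :: (real^'d) measure) borel" if "k \<in> I" for k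
  proof -
    have "(\<lambda>x. x k) \<in> measurable (\<Pi>\<^sub>M i\<in>I. uniform_sphere :: (real^'d) measure) uniform_sphere"
      by (rule measurable_component_singleton[OF that])
    from measurable_compose[OF this borel_measurable_uniform_sphere[of "\<lambda>y. y"]]
    show ?thesis by simp
  qed
  have "(\<lambda>x. x i \<bullet> x j) \<in> borel_measurable (\<Pi>\<^sub>M i\<in>I. uniform_sphere :: (real^'d) measure)"
    by (intro borel_measurable_inner comp assms)
  moreover have "poly p \<in> borel_measurable borel"
    by (intro borel_measurable_continuous_onI continuous_intros)
  ultimately show ?thesis by (rule measurable_compose)
qed

lemma abs_inner_le_1: "norm x = 1 \<Longrightarrow> norm y = 1 \<Longrightarrow> \<bar>x \<bullet> y\<bar> \<le> 1"
  using Cauchy_Schwarz_ineq2[of x y] by simp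

lemma integrable_poly_inner_mult:
  assumes "i \<in> I" "j \<in> I" "k \<in> I" "l \<in> I"
  shows "integrable (\<Pi>\<^sub>M i\<in>I. uniform_sphere :: (real^'d) measure)
    (\<lambda>x. poly p (x i \<bullet> x j) * poly q (x k \<bullet> x l))"
proof -
  interpret prob_space "\<Pi>\<^sub>M i\<in>I. uniform_sphere :: (real^'d) measure"
    by (intro prob_space_PiM prob_space_uniform_sphere)
  have "\<exists>B. \<forall>t. \<bar>t\<bar> \<le> 1 \<longrightarrow> norm (poly r t) \<le> B" for r :: "real poly"
  proof -
    have "compact (poly r ` {-1..1})"
      by (intro compact_continuous_image continuous_intros) auto
    then have "bounded (poly r ` {-1..1})" by (rule compact_imp_bounded)
    then show ?thesis unfolding bounded_iff by (metis abs_le_iff atLeastAtMost_iff imageI minus_le_iff)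
  qed
  then obtain B C where B: "\<And>t. \<bar>t\<bar> \<le> 1 \<Longrightarrow> norm (poly p t) \<le> B"
    and C: "\<And>t. \<bar>t\<bar> \<le> 1 \<Longrightarrow> norm (poly q t) \<le> C" by metis
  show ?thesis
  proof (rule integrable_const_bound[where B = "B * C"])
    show "AE x in \<Pi>\<^sub>M i\<in>I. (uniform_sphere :: (real^'d) measure). norm (poly p (x i \<bullet> x j) * poly q (x k \<bullet> x l)) \<le> B * C"
    proof (rule AE_I2)
      fix x assume x: "x \<in> space (\<Pi>\<^sub>M i\<in>I. uniform_sphere :: (real^'d) measure)"
      have "norm (poly p (x i \<bullet> x j)) \<le> B" "norm (poly q (x k \<bullet> x l)) \<le> C"
        by (intro B C abs_inner_le_1 space_PiM_uniform_sphere[OF x] assms)+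
      then show "norm (poly p (x i \<bullet> x j) * poly q (x k \<bullet> x l)) \<le> B * C"
        unfolding norm_mult by (intro mult_mono) (auto intro: order_trans[OF norm_ge_zero])
    qed
  qed (intro borel_measurable_times measurable_poly_inner assms)
qed

text \<open>A U-statistic kernel sum over ordered pairs. The diagonal is left out because on unit
  vectors it is the constant value of \<open>p\<close> at 1, so all randomness sits here.\<close>

definition cross_sum :: "nat \<Rightarrow> real poly \<Rightarrow> (nat \<Rightarrow> real^'d) \<Rightarrow> real" where
  "cross_sum n p x = (\<Sum>(i, j)\<in>(SIGMA i:{1..n}. {1..n} - {i}). poly p (x i \<bullet> x j))"

text \<open>Of two distinct unordered pairs, one contains an index missing from the other; integrating
  over that observation alone kills the product, so only \<open>(i, j)\<close> against \<open>(i, j)\<close> and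
  \<open>(j, i)\<close> contribute.\<close>

lemma integral_cross_sum_square_le:
  fixes p :: "real poly"
  assumes zero: "zonal_mean TYPE(real^'d) p = 0"
  shows "integrable (\<Pi>\<^sub>M i\<in>{1..n}. uniform_sphere) (\<lambda>x. (cross_sum n p (x :: nat \<Rightarrow> real^'d))\<^sup>2)" (is ?int)
    and "(\<integral>x. (cross_sum n p (x :: nat \<Rightarrow> real^'d))\<^sup>2 \<partial>(\<Pi>\<^sub>M i\<in>{1..n}. uniform_sphere))
      \<le> 2 * (real n)\<^sup>2 * zonal_mean TYPE(real^'d) (p * p)" (is ?le)
proof -
  let ?I = "{1..n}"
  let ?U = "uniform_sphere :: (real^'d) measure"
  let ?M = "\<Pi>\<^sub>M i\<in>?I. ?U"
  let ?P = "SIGMA i:?I. ?I - {i}"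
  define g where "g = (\<lambda>(i, j) (x :: nat \<Rightarrow> real^'d). poly p (x i \<bullet> x j))"
  define N where "N = zonal_mean TYPE(real^'d) (p * p)"
  have sq: "(cross_sum n p x)\<^sup>2 = (\<Sum>a\<in>?P. \<Sum>b\<in>?P. g a x * g b x)" for x :: "nat \<Rightarrow> real^'d"
    unfolding cross_sum_def g_def power2_eq_square sum_product by (simp add: case_prod_beta)
  have int: "integrable ?M (\<lambda>x. g a x * g b x)" if "a \<in> ?P" "b \<in> ?P" for a b
    using that by (auto simp: g_def intro!: integrable_poly_inner_mult)
  show ?int
    unfolding sq by (intro Bochner_Integration.integrable_sum int)
  have mean: "(\<integral>y. poly q (y \<bullet> z) \<partial>?U) = zonal_mean TYPE(real^'d) q" if "norm z = 1" for q and z :: "real^'d"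
    using integral_zonal[OF that] by simp
  have off: "(\<integral>x. poly p (x i \<bullet> x j) * poly p (x k \<bullet> x l) \<partial>?M) = 0"
    if "i \<in> ?I" "j \<in> ?I" "k \<in> ?I" "l \<in> ?I" "i \<noteq> j" "i \<noteq> k" "i \<noteq> l" for i j k l
  proof (rule integral_PiM_const_slice[where i = i])
    show "prob_space ?U" by (rule prob_space_uniform_sphere)
    show "integrable ?M (\<lambda>x. poly p (x i \<bullet> x j) * poly p (x k \<bullet> x l))"
      by (intro integrable_poly_inner_mult that)
    fix x assume x: "x \<in> space (\<Pi>\<^sub>M i\<in>?I - {i}. ?U)"
    have "norm (x j) = 1" using x that by (intro space_PiM_uniform_sphere[OF x]) auto
    then show "(\<integral>y. poly p ((x(i := y)) i \<bullet> (x(i := y)) j) * poly p ((x(i := y)) k \<bullet> (x(i := y)) l) \<partial>?U) = 0"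
      using that by (simp add: mean zero)
  qed (use that in auto)
  have diag: "(\<integral>x. poly p (x i \<bullet> x j) * poly p (x i \<bullet> x j) \<partial>?M) = N"
    if "i \<in> ?I" "j \<in> ?I" "i \<noteq> j" for i j
  proof (rule integral_PiM_const_slice[where i = i])
    show "prob_space ?U" by (rule prob_space_uniform_sphere)
    show "integrable ?M (\<lambda>x. poly p (x i \<bullet> x j) * poly p (x i \<bullet> x j))"
      by (intro integrable_poly_inner_mult that)
    fix x assume x: "x \<in> space (\<Pi>\<^sub>M i\<in>?I - {i}. ?U)"
    have "norm (x j) = 1" using x that by (intro space_PiM_uniform_sphere[OF x]) auto
    from mean[OF this, of "p * p"]
    show "(\<integral>y. poly p ((x(i := y)) i \<bullet> (x(i := y)) j) * poly p ((x(i := y)) i \<bullet> (x(i := y)) j) \<partial>?U) = N"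
      using that by (simp add: N_def)
  qed (use that in auto)
  have N: "N \<ge> 0"
    unfolding N_def zonal_mean_def by (intro integral_nonneg_AE AE_I2) simp
  have pair: "(\<integral>x. g a x * g b x \<partial>?M) = (if b = a \<or> b = prod.swap a then N else 0)"
    if "a \<in> ?P" "b \<in> ?P" for a b
  proof -
    obtain i j k l where ab: "a = (i, j)" "b = (k, l)" by (cases a, cases b)
    have I: "i \<in> ?I" "j \<in> ?I" "k \<in> ?I" "l \<in> ?I" "i \<noteq> j" "k \<noteq> l" using that ab by auto
    consider "b = a" | "b = prod.swap a" | "i \<noteq> k \<and> i \<noteq> l" | "j \<noteq> k \<and> j \<noteq> l"
      using I ab by auto
    then show ?thesis
    proof cases
      case 1
      then show ?thesis using diag[of i j] ab I by (simp add: g_def)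
    next
      case 2
      then show ?thesis using diag[of i j] ab I by (simp add: g_def inner_commute)
    next
      case 3
      then show ?thesis using off[of i j k l] ab I by (simp add: g_def)
    next
      case 4
      then show ?thesis using off[of j i k l] ab I by (auto simp add: g_def inner_commute)
    qed
  qed
  have "(\<integral>x. (cross_sum n p x)\<^sup>2 \<partial>?M) = (\<Sum>a\<in>?P. \<Sum>b\<in>?P. \<integral>x. g a x * g b x \<partial>?M)"
    unfolding sq
    by (subst Bochner_Integration.integral_sum, intro Bochner_Integration.integrable_sum int, assumption+)
      (intro sum.cong refl Bochner_Integration.integral_sum int)
  also have "\<dots> = (\<Sum>a\<in>?P. \<Sum>b\<in>?P. if b = a \<or> b = prod.swap a then N else 0)"
    by (intro sum.cong refl pair)
  also have "\<dots> \<le> (\<Sum>a\<in>?P. 2 * N)"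
  proof (rule sum_mono)
    fix a assume "a \<in> ?P"
    have "(\<Sum>b\<in>?P. if b = a \<or> b = prod.swap a then N else 0) = (\<Sum>b\<in>?P \<inter> {a, prod.swap a}. N)"
      by (subst sum.inter_restrict) (auto intro!: sum.cong)
    also have "\<dots> \<le> (\<Sum>b\<in>{a, prod.swap a}. N)"
      by (rule sum_mono2) (use N in auto)
    also have "\<dots> \<le> 2 * N"
      using N by (cases "a = prod.swap a") auto
    finally show "(\<Sum>b\<in>?P. if b = a \<or> b = prod.swap a then N else 0) \<le> 2 * N" .
  qed
  also have "\<dots> = real (card ?P) * (2 * N)" by simp
  also have "\<dots> \<le> (real n)\<^sup>2 * (2 * N)"
  proof (rule mult_right_mono)
    have "card ?P \<le> card (?I \<times> ?I)" by (intro card_mono) auto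
    also have "\<dots> = n\<^sup>2" by (simp add: power2_eq_square)
    finally show "real (card ?P) \<le> (real n)\<^sup>2" by (metis of_nat_le_iff of_nat_power)
  qed (use N in simp)
  finally show ?le by (simp add: N_def mult_ac)
qed

section \<open>The data-driven index\<close>

text \<open>Zonal reproducing kernel of the spherical harmonics of degrees 2 to m. Degree 1 is
  absent because \<open>tail_stat\<close> measures the excess of S_m over S_1.\<close>

definition tail_poly :: "nat \<Rightarrow> nat \<Rightarrow> real poly" where
  "tail_poly d m = (\<Sum>k = 2..m. smult (real (dim_harm d k)) (gegen (real d - 2) k))"

definition tail_dim :: "nat \<Rightarrow> nat \<Rightarrow> real" where
  "tail_dim d m = (\<Sum>k = 2..m. real (dim_harm d k))"

definition tail_stat :: "nat \<Rightarrow> (nat \<Rightarrow> real^'d) \<Rightarrow> nat \<Rightarrow> real" where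
  "tail_stat n x m = 1 / real n * (\<Sum>i = 1..n. \<Sum>j = 1..n. poly (tail_poly CARD('d) m) (x i \<bullet> x j))"

lemma poly_tail_poly_1: "d \<ge> 2 \<Longrightarrow> poly (tail_poly d m) 1 = tail_dim d m"
  by (simp add: tail_poly_def tail_dim_def poly_sum poly_gegen_1)

text \<open>Orthogonality leaves only d_k^2 E R_k^2 = d_k in the square. The second moment thus
  equals the value of the kernel at 1, the reproducing property that makes variance and mean
  comparable.\<close>

lemma zonal_mean_tail_poly:
  assumes "CARD('d) \<ge> 2"
  shows "zonal_mean TYPE(real^'d) (tail_poly CARD('d) m) = 0"
    and "zonal_mean TYPE(real^'d) (tail_poly CARD('d) m * tail_poly CARD('d) m) = tail_dim CARD('d) m"
proof -
  interpret gegenbauer_functional "real CARD('d) - 2" "zonal_mean TYPE(real^'d)"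
    by (rule gegenbauer_functional_zonal_mean[OF assms])
  let ?e = "real CARD('d) - 2"
  let ?d = "\<lambda>k. real (dim_harm CARD('d) k)"
  show "zonal_mean TYPE(real^'d) (tail_poly CARD('d) m) = 0"
    by (simp add: tail_poly_def L_sum L_smult L_gegen)
  have norm: "?d k * zonal_mean TYPE(real^'d) (gegen ?e k * gegen ?e k) = 1" if "k \<ge> 1" for k
    using dim_harm_L_gegen_square[OF that, of "CARD('d) - 2"] le_add_diff_inverse2[OF assms] assms
    by (simp only: of_nat_diff of_nat_numeral refl)
  have "tail_poly CARD('d) m * tail_poly CARD('d) m
      = (\<Sum>k = 2..m. \<Sum>l = 2..m. smult (?d k * ?d l) (gegen ?e k * gegen ?e l))"
    by (simp add: tail_poly_def sum_product mult.commute)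
  then have "zonal_mean TYPE(real^'d) (tail_poly CARD('d) m * tail_poly CARD('d) m)
      = (\<Sum>k = 2..m. \<Sum>l = 2..m. ?d k * ?d l * zonal_mean TYPE(real^'d) (gegen ?e k * gegen ?e l))"
    by (simp only: L_sum L_smult)
  also have "\<dots> = (\<Sum>k = 2..m. \<Sum>l = 2..m. if l = k then ?d k else 0)"
  proof (intro sum.cong refl)
    fix k l assume "k \<in> {2..m}" "l \<in> {2..m}"
    then show "?d k * ?d l * zonal_mean TYPE(real^'d) (gegen ?e k * gegen ?e l) = (if l = k then ?d k else 0)"
      using norm[of k] L_gegen_orthogonal[of k l] by (cases "l = k") (auto simp: mult.assoc)
  qed
  also have "\<dots> = tail_dim CARD('d) m"
    unfolding tail_dim_def by (intro sum.cong refl) (simp add: sum.delta)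
  finally show "zonal_mean TYPE(real^'d) (tail_poly CARD('d) m * tail_poly CARD('d) m) = tail_dim CARD('d) m" .
qed

lemma B_S_diff:
  fixes x :: "nat \<Rightarrow> real^'d"
  assumes "CARD('d) \<ge> 2" "\<And>i. i \<in> {1..n} \<Longrightarrow> norm (x i) = 1" "m \<ge> 1"
  shows "B_S n x m - B_S n x 1 = tail_stat n x m - tail_dim CARD('d) m * ln (real n)"
proof -
  have split: "(\<Sum>k = 1..m. f k) = f 1 + (\<Sum>k = 2..m. f k)" for f :: "nat \<Rightarrow> real"
    using assms(3) by (simp add: sum.atLeast_Suc_atMost numeral_2_eq_2)
  have h: "(\<Sum>k = 2..m. sobolev_h CARD('d) k (x i \<bullet> x j)) = poly (tail_poly CARD('d) m) (x i \<bullet> x j)"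
    if "i \<in> {1..n}" "j \<in> {1..n}" for i j
    unfolding tail_poly_def poly_sum
    by (intro sum.cong refl) (use abs_inner_le_1[OF assms(2)[OF that(1)] assms(2)[OF that(2)]] assms(1)
      in \<open>simp add: sobolev_h_eq_gegen\<close>)
  have "sobolev_stat n x m = sobolev_stat n x 1 +
      1 / real n * (\<Sum>i = 1..n. \<Sum>j = 1..n. \<Sum>k = 2..m. sobolev_h CARD('d) k (x i \<bullet> x j))"
    unfolding sobolev_stat_def split by (simp add: sum.distrib distrib_left)
  also have "(\<Sum>i = 1..n. \<Sum>j = 1..n. \<Sum>k = 2..m. sobolev_h CARD('d) k (x i \<bullet> x j))
      = (\<Sum>i = 1..n. \<Sum>j = 1..n. poly (tail_poly CARD('d) m) (x i \<bullet> x j))"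
    by (intro sum.cong refl h)
  finally have "sobolev_stat n x m = sobolev_stat n x 1 + tail_stat n x m"
    by (simp only: tail_stat_def)
  moreover have "real (penalty_dim CARD('d) m) = real (penalty_dim CARD('d) 1) + tail_dim CARD('d) m"
    unfolding penalty_dim_def of_nat_sum split tail_dim_def by simp
  ultimately show ?thesis by (simp add: B_S_def algebra_simps)
qed

text \<open>Since 1 is the least admissible index, the infimum is 1 exactly when 1 is a maximiser: a
  nonempty infimum in \<open>enat\<close> is attained, and the empty one is \<infinity>. Attaining
  the supremum at 1 means that the real number B_S(1) is an upper bound, which also covers an
  infinite supremum.\<close>

lemma k_hat_eq_1_iff: "k_hat n x = 1 \<longleftrightarrow> (\<forall>m\<ge>1. B_S n x m \<le> B_S n x 1)"
proof -
  let ?S = "SUP m\<in>{1..}. ereal (B_S n x m)"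
  let ?A = "{enat K | K. K \<ge> 1 \<and> ereal (B_S n x K) = ?S}"
  have "k_hat n x = 1 \<longleftrightarrow> 1 \<in> ?A"
  proof
    assume "k_hat n x = 1"
    then have "Inf ?A = 1" by (simp add: k_hat_def)
    moreover from this have "?A \<noteq> {}" by (metis Inf_enat_def infinity_ne_i1)
    ultimately show "1 \<in> ?A" by (metis (no_types, lifting) Inf_enat_def LeastI_ex ex_in_conv)
  next
    assume "1 \<in> ?A"
    moreover have "1 \<le> a" if "a \<in> ?A" for a
      using that by (auto simp: one_enat_def)
    ultimately show "k_hat n x = 1"
      unfolding k_hat_def by (metis (no_types, lifting) Inf_lower Inf_greatest antisym)
  qed
  also have "\<dots> \<longleftrightarrow> ereal (B_S n x 1) = ?S"
    by (auto simp: one_enat_def)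
  also have "\<dots> \<longleftrightarrow> ?S \<le> ereal (B_S n x 1)"
    by (auto intro: antisym SUP_upper)
  also have "\<dots> \<longleftrightarrow> (\<forall>m\<ge>1. B_S n x m \<le> B_S n x 1)"
    by (auto simp: SUP_le_iff)
  finally show ?thesis .
qed

lemma k_hat_neq_1_iff:
  fixes x :: "nat \<Rightarrow> real^'d"
  assumes "CARD('d) \<ge> 2" "\<And>i. i \<in> {1..n} \<Longrightarrow> norm (x i) = 1"
  shows "k_hat n x \<noteq> 1 \<longleftrightarrow> (\<exists>m\<ge>2. tail_stat n x m > tail_dim CARD('d) m * ln (real n))"
proof -
  have "k_hat n x \<noteq> 1 \<longleftrightarrow> (\<exists>m\<ge>1. B_S n x m - B_S n x 1 > 0)"
    unfolding k_hat_eq_1_iff by (auto simp: not_le)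
  also have "\<dots> \<longleftrightarrow> (\<exists>m\<ge>2. B_S n x m - B_S n x 1 > 0)"
  proof
    assume "\<exists>m\<ge>1. B_S n x m - B_S n x 1 > 0"
    then obtain m where "m \<ge> 1" "B_S n x m - B_S n x 1 > 0" by auto
    moreover from this have "m \<noteq> 1" by auto
    ultimately show "\<exists>m\<ge>2. B_S n x m - B_S n x 1 > 0" by (intro exI[of _ m]) auto
  next
    assume "\<exists>m\<ge>2. B_S n x m - B_S n x 1 > 0"
    then show "\<exists>m\<ge>1. B_S n x m - B_S n x 1 > 0" by (meson one_le_numeral order_trans)
  qed
  also have "\<dots> \<longleftrightarrow> (\<exists>m\<ge>2. tail_stat n x m > tail_dim CARD('d) m * ln (real n))"
  proof -
    have "B_S n x m - B_S n x 1 > 0 \<longleftrightarrow> tail_stat n x m > tail_dim CARD('d) m * ln (real n)"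
      if "m \<ge> 2" for m
      using B_S_diff[OF assms, where m = m] that by simp
    then show ?thesis by blast
  qed
  finally show ?thesis .
qed

text \<open>Each of the \<open>n\<close> diagonal terms is the kernel at 1, so after division by
  \<open>n\<close> they leave a deterministic centring.\<close>

lemma tail_stat_eq_cross_sum:
  fixes x :: "nat \<Rightarrow> real^'d"
  assumes "CARD('d) \<ge> 2" "\<And>i. i \<in> {1..n} \<Longrightarrow> norm (x i) = 1" "n \<ge> 1"
  shows "tail_stat n x m = tail_dim CARD('d) m + cross_sum n (tail_poly CARD('d) m) x / real n"
proof -
  let ?p = "tail_poly CARD('d) m"
  have "(\<Sum>i = 1..n. \<Sum>j = 1..n. poly ?p (x i \<bullet> x j))
      = (\<Sum>i = 1..n. tail_dim CARD('d) m + (\<Sum>j\<in>{1..n} - {i}. poly ?p (x i \<bullet> x j)))"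
  proof (rule sum.cong)
    fix i assume i: "i \<in> {1..n}"
    then have "x i \<bullet> x i = 1" using assms(2)[OF i] by (simp add: dot_square_norm)
    then show "(\<Sum>j = 1..n. poly ?p (x i \<bullet> x j))
        = tail_dim CARD('d) m + (\<Sum>j\<in>{1..n} - {i}. poly ?p (x i \<bullet> x j))"
      using i by (subst sum.remove[of _ i]) (auto simp: poly_tail_poly_1 assms(1))
  qed simp
  also have "\<dots> = real n * tail_dim CARD('d) m + cross_sum n ?p x"
    unfolding cross_sum_def by (subst sum.Sigma[symmetric]) (auto simp: sum.distrib)
  finally show ?thesis
    using assms(3) by (simp add: tail_stat_def field_simps)
qed

lemma measurable_tail_stat:
  "(\<lambda>x. tail_stat n x m) \<in> borel_measurable (\<Pi>\<^sub>M i\<in>{1..n}. uniform_sphere :: (real^'d) measure)"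
  unfolding tail_stat_def
  by (intro borel_measurable_times borel_measurable_const borel_measurable_sum measurable_poly_inner)

lemma prob_tail_stat_ge:
  assumes d: "CARD('d) \<ge> 2" and n: "n \<ge> 1" and c: "c > 1" and q: "tail_dim CARD('d) m > 0"
  shows "measure (\<Pi>\<^sub>M i\<in>{1..n}. uniform_sphere)
      {x \<in> space (\<Pi>\<^sub>M i\<in>{1..n}. uniform_sphere). tail_stat n (x :: nat \<Rightarrow> real^'d) m \<ge> tail_dim CARD('d) m * c}
    \<le> 2 / (tail_dim CARD('d) m * (c - 1)\<^sup>2)"
proof -
  let ?M = "\<Pi>\<^sub>M i\<in>{1..n}. uniform_sphere :: (real^'d) measure"
  let ?q = "tail_dim CARD('d) m"
  let ?W = "\<lambda>x. cross_sum n (tail_poly CARD('d) m) (x :: nat \<Rightarrow> real^'d)"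
  \<comment> \<open>Exceeding q c means exceeding the centring q by q(c-1); the factor
    \<open>n\<close> undoes the normalisation. Against the second moment 2 n^2 q this yields 2 / (q
    (c-1)^2).\<close>
  define a where "a = real n * ?q * (c - 1)"
  have a: "a > 0" using n c q by (simp add: a_def)
  interpret prob_space ?M by (intro prob_space_PiM prob_space_uniform_sphere)
  note W = integral_cross_sum_square_le[OF zonal_mean_tail_poly(1)[OF d, of m], of n]
  have "prob {x \<in> space ?M. tail_stat n x m \<ge> ?q * c} \<le> prob {x \<in> space ?M. (?W x)\<^sup>2 \<ge> a\<^sup>2}"
  proof (rule finite_measure_mono)
    show "{x \<in> space ?M. tail_stat n x m \<ge> ?q * c} \<subseteq> {x \<in> space ?M. (?W x)\<^sup>2 \<ge> a\<^sup>2}"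
    proof safe
      fix x assume x: "x \<in> space ?M" and "tail_stat n x m \<ge> ?q * c"
      then have "?q + ?W x / real n \<ge> ?q * c"
        using tail_stat_eq_cross_sum[OF d space_PiM_uniform_sphere[OF x] n, where m = m] by simp
      then have "?W x \<ge> a" using n by (simp add: a_def field_simps)
      then show "(?W x)\<^sup>2 \<ge> a\<^sup>2" using a by (intro power_mono) auto
    qed
    show "{x \<in> space ?M. (?W x)\<^sup>2 \<ge> a\<^sup>2} \<in> events"
      using borel_measurable_integrable[OF W(1)] by measurable
  qed
  also have "\<dots> \<le> (\<integral>x. (?W x)\<^sup>2 \<partial>?M) / a\<^sup>2"
    by (rule integral_Markov_inequality_measure[OF W(1), of "{}"]) (use a in auto)
  also have "\<dots> \<le> (2 * (real n)\<^sup>2 * ?q) / a\<^sup>2"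
    using W(2) unfolding zonal_mean_tail_poly(2)[OF d] by (intro divide_right_mono) auto
  also have "\<dots> = 2 / (?q * (c - 1)\<^sup>2)"
    using n q c by (simp add: a_def power_mult_distrib power2_eq_square[of ?q])
  finally show ?thesis .
qed

section \<open>Growth of the penalties, and the circle\<close>

lemma tail_dim_ge_square:
  assumes "d \<ge> 3" "m \<ge> 2"
  shows "tail_dim d m \<ge> (real m)\<^sup>2 / 4"
proof -
  \<comment> \<open>Linear growth of the dimensions is enough: it makes their sums quadratic, hence
    the reciprocals of the sums summable.\<close>
  have "real (dim_harm d k) \<ge> real k" for k
  proof -
    obtain e where d: "d = Suc e + 2" using assms(1) by (intro that[of "d - 3"]) simp
    have "Suc e + k choose Suc e \<ge> k"
    proof (induction e)
      case (Suc e)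
      have "Suc (Suc e) + k choose Suc (Suc e) = (Suc e + k choose Suc e) + (Suc e + k choose Suc (Suc e))"
        by simp
      then show ?case using Suc by linarith
    qed simp
    then show ?thesis using d by (simp add: dim_harm_def)
  qed
  then have "tail_dim d m \<ge> (\<Sum>k = 2..m. real k)"
    unfolding tail_dim_def by (intro sum_mono)
  moreover have "(\<Sum>k = 2..m. real k) \<ge> (real m)\<^sup>2 / 4"
    using assms(2)
  proof (induction m rule: nat_induct_at_least)
    case (Suc m)
    then have "real m \<ge> 2" by simp
    then show ?case using Suc by (simp add: power2_eq_square field_simps)
  qed simp
  ultimately show ?thesis by linarith
qed

lemma dim_harm_2: "k \<ge> 1 \<Longrightarrow> dim_harm 2 k = 2"
  by (simp add: dim_harm_def)

lemma tail_dim_2: "m \<ge> 1 \<Longrightarrow> tail_dim 2 m = 2 * (real m - 1)"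
  by (simp add: tail_dim_def dim_harm_2 of_nat_diff)

text \<open>With x_i at angle t_i the double sum of cos(k(t_i - t_j)) is the squared modulus of the
  sum of exp(i k t_j), written out through its real and imaginary parts.\<close>

lemma sum_poly_gegen_circle_nonneg:
  fixes x :: "nat \<Rightarrow> real^'d"
  assumes "CARD('d) = 2" "\<And>i. i \<in> {1..n} \<Longrightarrow> norm (x i) = 1"
  shows "(\<Sum>i = 1..n. \<Sum>j = 1..n. poly (gegen 0 k) (x i \<bullet> x j)) \<ge> 0"
proof -
  obtain a b :: 'd where ab: "UNIV = {a, b}" "a \<noteq> b"
    using assms(1) by (auto simp: card_2_iff)
  have "\<exists>t. x i $ a = cos t \<and> x i $ b = sin t" if "i \<in> {1..n}" for i
  proof -
    have "(x i $ a)\<^sup>2 + (x i $ b)\<^sup>2 = 1"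
      using norm_1_sum_squares[OF assms(2)[OF that]] ab(2) unfolding ab(1) by simp
    then show ?thesis using sincos_total_2pi by metis
  qed
  then obtain t where t: "\<And>i. i \<in> {1..n} \<Longrightarrow> x i $ a = cos (t i) \<and> x i $ b = sin (t i)"
    by metis
  have "(\<Sum>i = 1..n. \<Sum>j = 1..n. poly (gegen 0 k) (x i \<bullet> x j))
      = (\<Sum>i = 1..n. \<Sum>j = 1..n. cos (real k * t i) * cos (real k * t j) + sin (real k * t i) * sin (real k * t j))"
  proof (intro sum.cong refl)
    fix i j assume i: "i \<in> {1..n}" "j \<in> {1..n}"
    have "x i \<bullet> x j = cos (t i - t j)"
      using t[OF i(1)] t[OF i(2)] ab(2) unfolding inner_vec_def ab(1) by (simp add: cos_diff)
    then have "poly (gegen 0 k) (x i \<bullet> x j) = cos (real k * (t i - t j))"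
      by (simp only: poly_gegen_cos)
    then show "poly (gegen 0 k) (x i \<bullet> x j)
        = cos (real k * t i) * cos (real k * t j) + sin (real k * t i) * sin (real k * t j)"
      by (simp only: right_diff_distrib cos_diff)
  qed
  also have "\<dots> = (\<Sum>i = 1..n. cos (real k * t i))\<^sup>2 + (\<Sum>i = 1..n. sin (real k * t i))\<^sup>2"
    by (simp add: sum.distrib sum_product power2_eq_square)
  finally show ?thesis by simp
qed

lemma tail_stat_mono_circle:
  fixes x :: "nat \<Rightarrow> real^'d"
  assumes "CARD('d) = 2" "\<And>i. i \<in> {1..n} \<Longrightarrow> norm (x i) = 1" "m \<le> m'"
  shows "tail_stat n x m \<le> tail_stat n x m'"
proof -
  have eq: "tail_stat n x m = 1 / real n *
      (\<Sum>k = 2..m. real (dim_harm 2 k) * (\<Sum>i = 1..n. \<Sum>j = 1..n. poly (gegen 0 k) (x i \<bullet> x j)))" for m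
  proof -
    have "(\<Sum>i = 1..n. \<Sum>j = 1..n. poly (tail_poly 2 m) (x i \<bullet> x j))
        = (\<Sum>i = 1..n. \<Sum>k = 2..m. \<Sum>j = 1..n. real (dim_harm 2 k) * poly (gegen 0 k) (x i \<bullet> x j))"
      unfolding tail_poly_def poly_sum by (subst sum.swap) simp
    also have "\<dots> = (\<Sum>k = 2..m. \<Sum>i = 1..n. \<Sum>j = 1..n. real (dim_harm 2 k) * poly (gegen 0 k) (x i \<bullet> x j))"
      by (rule sum.swap)
    finally show ?thesis unfolding tail_stat_def assms(1) by (simp add: sum_distrib_left)
  qed
  show ?thesis
    unfolding eq
    by (intro mult_left_mono sum_mono2 mult_nonneg_nonneg sum_poly_gegen_circle_nonneg assms) (use assms(3) in auto)
qed

text \<open>For \<open>d = 2\<close> the series of the reciprocals of \<^const>\<open>tail_dim\<close> diverges; it is thinned out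
  to dyadic indices, which is harmless because there \<^const>\<open>tail_stat\<close> is monotone.\<close>

lemma obtain_summable_skeleton:
  assumes d: "CARD('d) \<ge> 2"
  obtains M :: "nat \<Rightarrow> nat" where
    "\<forall>l. tail_dim CARD('d) (M l) > 0"
    "summable (\<lambda>l. 1 / tail_dim CARD('d) (M l))"
    "\<forall>n (x :: nat \<Rightarrow> real^'d) m c. (\<forall>i\<in>{1..n}. norm (x i) = 1) \<longrightarrow> m \<ge> 2 \<longrightarrow> c \<ge> 0 \<longrightarrow>
       tail_stat n x m > tail_dim CARD('d) m * c \<longrightarrow>
       (\<exists>l. tail_stat n x (M l) \<ge> tail_dim CARD('d) (M l) * (c / 2))"
proof (cases "CARD('d) = 2")
  case True
  \<comment> \<open>The final +1 makes the penalty an exact power of two. If 2^l \<le> m-1 <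
    2^(l+1), then m \<le> M l, and the penalty at M l is at most twice that at m; this is where
    \<open>c / 2\<close> comes from.\<close>
  define M :: "nat \<Rightarrow> nat" where "M l = 2 ^ (l + 1) + 1" for l
  have q: "tail_dim CARD('d) (M l) = 4 * 2 ^ l" for l
    using True by (simp add: tail_dim_2 M_def)
  show ?thesis
  proof (rule that[of M])
    show "\<forall>l. tail_dim CARD('d) (M l) > 0" by (simp add: q)
    have "summable (\<lambda>l. (1 / 4) * (1 / 2 :: real) ^ l)"
      by (intro summable_mult summable_geometric) simp
    then show "summable (\<lambda>l. 1 / tail_dim CARD('d) (M l))"
      by (simp add: q power_divide)
  next
    show "\<forall>n (x :: nat \<Rightarrow> real^'d) m c. (\<forall>i\<in>{1..n}. norm (x i) = 1) \<longrightarrow> m \<ge> 2 \<longrightarrow> c \<ge> 0 \<longrightarrow>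
       tail_stat n x m > tail_dim CARD('d) m * c \<longrightarrow>
       (\<exists>l. tail_stat n x (M l) \<ge> tail_dim CARD('d) (M l) * (c / 2))"
    proof (intro allI impI)
      fix n m :: nat and x :: "nat \<Rightarrow> real^'d" and c :: real
      assume x: "\<forall>i\<in>{1..n}. norm (x i) = 1" and m: "m \<ge> 2" and c: "c \<ge> 0"
        and gt: "tail_stat n x m > tail_dim CARD('d) m * c"
      have "m - 1 \<ge> 1" using m by simp
      then obtain l where l: "2 ^ l \<le> m - 1" "m - 1 < 2 ^ (l + 1)"
        using ex_power_ivl1[of 2 "m - 1"] by auto
      have "real (2 ^ l) \<le> real (m - 1)" using l(1) by (rule of_nat_mono)
      then have "tail_dim CARD('d) m \<ge> 2 * 2 ^ l"
        using True m by (simp add: tail_dim_2 of_nat_diff)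
      then have "tail_dim CARD('d) (M l) * (c / 2) \<le> tail_dim CARD('d) m * c"
        using c mult_right_mono[of "2 * 2 ^ l" "tail_dim CARD('d) m" c] by (simp add: q mult_ac)
      also have "\<dots> \<le> tail_stat n x m" using gt by simp
      also have "\<dots> \<le> tail_stat n x (M l)"
        using l(2) x by (intro tail_stat_mono_circle True) (auto simp: M_def)
      finally show "\<exists>l. tail_stat n x (M l) \<ge> tail_dim CARD('d) (M l) * (c / 2)" by blast
    qed
  qed
next
  case False
  then have d3: "CARD('d) \<ge> 3" using d by simp
  have q: "tail_dim CARD('d) (l + 2) \<ge> (real (l + 2))\<^sup>2 / 4" for l
    using tail_dim_ge_square[OF d3, of "l + 2"] by simp
  have pos: "tail_dim CARD('d) (l + 2) > 0" for l
    by (rule less_le_trans[OF _ q]) simp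
  show ?thesis
  proof (rule that[of "\<lambda>l. l + 2"])
    show "\<forall>l. tail_dim CARD('d) (l + 2) > 0" by (intro allI pos)
    have "summable (\<lambda>l. inverse (real l ^ 2))"
      by (rule inverse_power_summable) simp
    then have "summable (\<lambda>l. 4 * inverse (real (l + 2) ^ 2))"
      by (intro summable_mult) (rule summable_ignore_initial_segment)
    then show "summable (\<lambda>l. 1 / tail_dim CARD('d) (l + 2))"
    proof (rule summable_comparison_test'[where N = 0])
      fix l :: nat
      have "norm (1 / a) \<le> 4 * inverse b" if "a \<ge> b / 4" "b > 0" for a b :: real
      proof -
        have "a > 0" using that by linarith
        then show ?thesis using that by (simp add: field_simps)
      qed
      from this[OF q] show "norm (1 / tail_dim CARD('d) (l + 2)) \<le> 4 * inverse (real (l + 2) ^ 2)"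
        by simp
    qed
  next
    show "\<forall>n (x :: nat \<Rightarrow> real^'d) m c. (\<forall>i\<in>{1..n}. norm (x i) = 1) \<longrightarrow> m \<ge> 2 \<longrightarrow> c \<ge> 0 \<longrightarrow>
       tail_stat n x m > tail_dim CARD('d) m * c \<longrightarrow>
       (\<exists>l. tail_stat n x (l + 2) \<ge> tail_dim CARD('d) (l + 2) * (c / 2))"
    proof (intro allI impI)
      fix n m :: nat and x :: "nat \<Rightarrow> real^'d" and c :: real
      assume m: "m \<ge> 2" and c: "c \<ge> 0" and gt: "tail_stat n x m > tail_dim CARD('d) m * c"
      obtain l where l: "m = l + 2" using m by (metis add.commute le_Suc_ex)
      \<comment> \<open>Here every m \<ge> 2 is kept, so halving \<open>c\<close> costs nothing; it
        only gives both cases the same conclusion.\<close>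
      have "tail_dim CARD('d) (l + 2) * (c / 2) \<le> tail_dim CARD('d) (l + 2) * c"
        using c pos[of l] by (intro mult_left_mono) auto
      then have "tail_stat n x (l + 2) \<ge> tail_dim CARD('d) (l + 2) * (c / 2)"
        using gt unfolding l by linarith
      then show "\<exists>l. tail_stat n x (l + 2) \<ge> tail_dim CARD('d) (l + 2) * (c / 2)" ..
    qed
  qed
qed

section \<open>The event that the index differs from 1\<close>

lemma k_hat_neq_1_event:
  assumes d: "CARD('d) \<ge> 2"
  shows "{x \<in> space (\<Pi>\<^sub>M i\<in>{1..n}. uniform_sphere). k_hat n (x :: nat \<Rightarrow> real^'d) \<noteq> 1}
    \<in> sets (\<Pi>\<^sub>M i\<in>{1..n}. uniform_sphere)"
proof -
  let ?M = "\<Pi>\<^sub>M i\<in>{1..n}. uniform_sphere :: (real^'d) measure"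
  \<comment> \<open>Contiguity speaks of measurable events only. On unit vectors this one is a
    countable union over \<open>m\<close> of threshold events of measurable statistics.\<close>
  have "{x \<in> space ?M. k_hat n x \<noteq> 1}
      = {x \<in> space ?M. \<exists>m. m \<ge> 2 \<and> tail_dim CARD('d) m * ln (real n) < tail_stat n x m}"
    by (intro Collect_cong conj_cong refl k_hat_neq_1_iff[OF d] space_PiM_uniform_sphere)
  also have "\<dots> \<in> sets ?M"
    using measurable_tail_stat[where 'd = 'd and n = n]
    by (intro sets.sets_Collect_countable_Ex sets.sets_Collect_conj sets.sets_Collect_const
        borel_measurable_less borel_measurable_const) auto
  finally show ?thesis .
qed

text \<open>In the bound for each skeleton event the dependence on \<open>n\<close> and on
  \<open>l\<close> separates, so summing over \<open>l\<close> gives a fixed constant times a null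
  sequence. Halving the threshold replaces log n - 1 by (log n)/2 - 1, which still diverges.\<close>

lemma uniform_prob_k_hat_neq_1:
  assumes d: "CARD('d) \<ge> 2"
  shows "(\<lambda>n. measure (\<Pi>\<^sub>M i\<in>{1..n}. uniform_sphere)
      {x \<in> space (\<Pi>\<^sub>M i\<in>{1..n}. uniform_sphere). k_hat n (x :: nat \<Rightarrow> real^'d) \<noteq> 1}) \<longlonglongrightarrow> 0"
proof -
  let ?M = "\<lambda>n. \<Pi>\<^sub>M i\<in>{1..n}. uniform_sphere :: (real^'d) measure"
  let ?q = "tail_dim CARD('d)"
  obtain M :: "nat \<Rightarrow> nat" where pos: "\<forall>l. ?q (M l) > 0"
    and summ: "summable (\<lambda>l. 1 / ?q (M l))"
    and skel: "\<forall>n (x :: nat \<Rightarrow> real^'d) m c. (\<forall>i\<in>{1..n}. norm (x i) = 1) \<longrightarrow> m \<ge> 2 \<longrightarrow> c \<ge> 0 \<longrightarrow>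
       tail_stat n x m > ?q m * c \<longrightarrow> (\<exists>l. tail_stat n x (M l) \<ge> ?q (M l) * (c / 2))"
    by (rule obtain_summable_skeleton[OF d])
  define C where "C = (\<Sum>l. 1 / ?q (M l))"
  let ?b = "\<lambda>n. 2 * C / (ln (real n) / 2 - 1)\<^sup>2"
  have lim: "filterlim (\<lambda>n. ln (real n) / 2 - 1) at_top sequentially"
  proof -
    have "filterlim (\<lambda>n. ln (real n)) at_top sequentially"
      by (rule filterlim_compose[OF ln_at_top filterlim_real_sequentially])
    then have "filterlim (\<lambda>n. - 1 + (1 / 2) * ln (real n)) at_top sequentially"
      by (intro filterlim_tendsto_add_at_top[OF tendsto_const]
          filterlim_tendsto_pos_mult_at_top[OF tendsto_const]) auto
    then show ?thesis by simp
  qed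
  have bound: "measure (?M n) {x \<in> space (?M n). k_hat n x \<noteq> 1} \<le> ?b n"
    if n: "n \<ge> 1" and large: "ln (real n) / 2 - 1 > 0" for n
  proof -
    interpret prob_space "?M n" by (intro prob_space_PiM prob_space_uniform_sphere)
    let ?c = "ln (real n) / 2"
    let ?E = "\<lambda>l. {x \<in> space (?M n). tail_stat n x (M l) \<ge> ?q (M l) * ?c}"
    have E: "?E l \<in> events" for l
      using measurable_tail_stat[where 'd = 'd and n = n and m = "M l"] by measurable
    have le: "prob (?E l) \<le> 2 / (?c - 1)\<^sup>2 * (1 / ?q (M l))" for l
      using prob_tail_stat_ge[OF d n _ pos[rule_format], of ?c l] large by (simp add: mult.commute)
    have s: "summable (\<lambda>l. 2 / (?c - 1)\<^sup>2 * (1 / ?q (M l)))"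
      by (rule summable_mult[OF summ])
    then have s': "summable (\<lambda>l. prob (?E l))"
      by (rule summable_comparison_test'[where N = 0]) (use le in simp)
    have "{x \<in> space (?M n). k_hat n x \<noteq> 1} \<subseteq> (\<Union>l. ?E l)"
    proof safe
      fix x assume x: "x \<in> space (?M n)" and "k_hat n x \<noteq> 1"
      note unit = space_PiM_uniform_sphere[OF x]
      obtain m where "m \<ge> 2" "tail_stat n x m > ?q m * ln (real n)"
        using k_hat_neq_1_iff[OF d unit] \<open>k_hat n x \<noteq> 1\<close> by auto
      then obtain l where "tail_stat n x (M l) \<ge> ?q (M l) * ?c"
        using skel[rule_format, where n = n and x = x and m = m and c = "ln (real n)"] unit n by auto
      then show "x \<in> (\<Union>l. ?E l)" using x by blast
    qed
    then have "prob {x \<in> space (?M n). k_hat n x \<noteq> 1} \<le> prob (\<Union>l. ?E l)"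
      using E by (intro finite_measure_mono) auto
    also have "\<dots> \<le> (\<Sum>l. prob (?E l))"
      using E s' by (intro finite_measure_subadditive_countably) auto
    also have "\<dots> \<le> (\<Sum>l. 2 / (?c - 1)\<^sup>2 * (1 / ?q (M l)))"
      by (rule suminf_le[OF le s' s])
    also have "\<dots> = ?b n"
      unfolding C_def suminf_mult[OF summ] by simp
    finally show ?thesis .
  qed
  have "\<forall>\<^sub>F n in sequentially. ln (real n) / 2 - 1 > 0"
    using lim unfolding filterlim_at_top_dense by (rule spec)
  then have le: "\<forall>\<^sub>F n in sequentially. measure (?M n) {x \<in> space (?M n). k_hat n x \<noteq> 1} \<le> ?b n"
    using eventually_ge_at_top[of 1] by eventually_elim (rule bound)
  have lim0: "?b \<longlonglongrightarrow> 0"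
    by (intro tendsto_divide_0[OF tendsto_const] filterlim_at_top_imp_at_infinity
        filterlim_pow_at_top lim) simp
  show ?thesis
    by (rule tendsto_sandwich[OF _ le tendsto_const lim0]) simp
qed

theorem lemma4p1:
  fixes \<nu> :: "nat \<Rightarrow> (real^'d) measure"
  assumes "CARD('d) \<ge> 2"
    and "\<And>n. prob_space (\<nu> n)"
    and "\<And>n. sets (\<nu> n) = sets unit_sphere_space"
    and "(\<lambda>n. iid_law n (\<nu> n)) \<lhd>\<^sub>c (\<lambda>n. iid_law n uniform_sphere)"
  shows "(\<lambda>n. measure (iid_law n (\<nu> n)) {x \<in> space (iid_law n (\<nu> n)). k_hat n x = 1}) \<longlonglongrightarrow> 1"
proof -
  let ?U = "\<lambda>n. iid_law n (uniform_sphere :: (real^'d) measure)"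
  let ?V = "\<lambda>n. iid_law n (\<nu> n)"
  let ?A = "\<lambda>n. {x \<in> space (?U n). k_hat n x \<noteq> 1}"
  \<comment> \<open>Both laws live on the same sigma-algebra, hence on the same space, so the event
    built for uniform observations can be measured under either law and complemented there.\<close>
  have sets: "sets (?V n) = sets (?U n)" for n
    unfolding iid_law_def by (intro sets_PiM_cong refl) (simp add: assms(3) sets_uniform_sphere)
  have A: "?A n \<in> sets (?U n)" for n
    unfolding iid_law_def by (rule k_hat_neq_1_event[OF assms(1)])
  have "(\<lambda>n. measure (?U n) (?A n)) \<longlonglongrightarrow> 0"
    unfolding iid_law_def by (rule uniform_prob_k_hat_neq_1[OF assms(1)])
  with assms(4)[unfolded contiguous_def, rule_format, of ?A] A
  have "(\<lambda>n. measure (?V n) (?A n)) \<longlonglongrightarrow> 0" by simp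
  then have "(\<lambda>n. 1 - measure (?V n) (?A n)) \<longlonglongrightarrow> 1 - 0"
    by (intro tendsto_diff tendsto_const)
  moreover have "measure (?V n) {x \<in> space (?V n). k_hat n x = 1} = 1 - measure (?V n) (?A n)" for n
  proof -
    interpret prob_space "?V n"
      unfolding iid_law_def by (intro prob_space_PiM assms(2))
    have "{x \<in> space (?V n). k_hat n x = 1} = space (?V n) - ?A n"
      using sets_eq_imp_space_eq[OF sets] by auto
    then show ?thesis using prob_compl[of "?A n"] A sets by simp
  qed
  ultimately show ?thesis by simp
qed

end
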